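(* Assume that the following holds: for every dimension $d\ge 1$ and every $\sigma$ with $\sigma>4/d$ and, if $d>4$, also $\sigma<\frac{4}{d-4}$, there exist $\tilde\kappa>0$ and $\tilde S\not\equiv 0$ such that $(\tilde S,\tilde\kappa)$ solves the profile problem $\mathrm{(P)}$ of the context with $\nu=1$ and $\kappa=\tilde\kappa$. Let $d,\sigma$ be in this range, let $\nu\in\mathbb{R}$, $\kappa>0$, and let $S(\rho)=S(\rho;\kappa,\nu)$ be a nontrivial solution of the profile problem $\mathrm{(P)}$ with parameters $\nu,\kappa$. Let $T_c>0$. Then $$\psi_S(t,r)=\frac{1}{L^{2/\sigma}(t)}\,S\!\left(\frac{r}{L(t)}\right)e^{\,i\nu\int_0^{t}\frac{1}{L^4(s)}\,ds},\qquad L(t)=\kappa\,(T_c-t)^{1/4},\qquad r=|\mathbf{x}|,$$ is a solution for $0\le t<T_c$ of the biharmonic nonlinear Schrödinger equation $$i\psi_t(t,\mathbf{x})-\Delta^2\psi+|\psi|^{2\sigma}\psi=0,\qquad \mathbf{x}\in\mathbb{R}^d.$$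
   Context: $\Delta^2$ is the biharmonic operator on $\mathbb{R}^d$. On radial functions it acts as $$\Delta_\rho^2=\partial_\rho^4+\frac{2(d-1)}{\rho}\partial_\rho^3+\frac{(d-1)(d-3)}{\rho^2}\partial_\rho^2-\frac{(d-1)(d-3)}{\rho^3}\partial_\rho .$$ Profile problem $\mathrm{(P)}$ with parameters $\nu\in\mathbb{R}$, $\kappa>0$: a complex-valued function $S(\rho)$, $\rho\ge 0$, satisfying $$-\nu S(\rho)+i\frac{\kappa^4}{4}\left(\frac{2}{\sigma}S+\rho S'\right)-\Delta_\rho^2S+|S|^{2\sigma}S=0,$$ $$S'(0)=S'''(0)=0,\qquad S(\infty):=\lim_{\rho\to\infty}S(\rho)=0.$$ Solutions are understood in the classical sense. *)

theory Defs
  imports "HOL-Analysis.Analysis"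
begin

definition admissible :: "nat \<Rightarrow> real \<Rightarrow> bool" where
  "admissible d \<sigma> \<longleftrightarrow>
     d \<ge> 1 \<and> \<sigma> > 4 / real d \<and> (d > 4 \<longrightarrow> \<sigma> < 4 / (real d - 4))"

subsection \<open>The profile problem\<close>

text \<open>Derivative on the half-line \<open>[0,\<infinity>)\<close>: one-sided at \<open>0\<close>, the usual derivative at \<open>\<rho> > 0\<close>
  (and not meaningful for \<open>\<rho> < 0\<close>).\<close>

definition hderiv :: "(real \<Rightarrow> complex) \<Rightarrow> real \<Rightarrow> complex" where
  "hderiv f \<rho> = vector_derivative f (at \<rho> within {0..})"

definition C4_halfline :: "(real \<Rightarrow> complex) \<Rightarrow> bool" where
  "C4_halfline f \<longleftrightarrow>
     (\<forall>k<4. \<forall>\<rho>\<ge>0. (hderiv ^^ k) f differentiable (at \<rho> within {0..})) \<and>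
     continuous_on {0..} ((hderiv ^^ 4) f)"

definition radial_bilaplacian :: "nat \<Rightarrow> (real \<Rightarrow> complex) \<Rightarrow> real \<Rightarrow> complex" where
  "radial_bilaplacian d f \<rho> =
     (hderiv ^^ 4) f \<rho>
     + of_real (2 * (real d - 1) / \<rho>) * (hderiv ^^ 3) f \<rho>
     + of_real ((real d - 1) * (real d - 3) / \<rho>\<^sup>2) * (hderiv ^^ 2) f \<rho>
     - of_real ((real d - 1) * (real d - 3) / \<rho> ^ 3) * hderiv f \<rho>"

text \<open>The equation is imposed for \<open>\<rho> > 0\<close> only, since its coefficients are singular at \<open>0\<close>.\<close>

definition profile_solution ::
    "nat \<Rightarrow> real \<Rightarrow> real \<Rightarrow> real \<Rightarrow> (real \<Rightarrow> complex) \<Rightarrow> bool" where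
  "profile_solution d \<sigma> \<nu> \<kappa> S \<longleftrightarrow>
     C4_halfline S \<and>
     (\<forall>\<rho>>0. - of_real \<nu> * S \<rho>
        + \<i> * of_real (\<kappa> ^ 4 / 4) * (of_real (2 / \<sigma>) * S \<rho> + of_real \<rho> * hderiv S \<rho>)
        - radial_bilaplacian d S \<rho>
        + of_real (norm (S \<rho>) powr (2 * \<sigma>)) * S \<rho> = 0) \<and>
     hderiv S 0 = 0 \<and> (hderiv ^^ 3) S 0 = 0 \<and>
     (S \<longlongrightarrow> 0) at_top"

definition nontrivial_profile :: "(real \<Rightarrow> complex) \<Rightarrow> bool" where
  "nontrivial_profile S \<longleftrightarrow> (\<exists>\<rho>\<ge>0. S \<rho> \<noteq> 0)"

subsection \<open>The biharmonic nonlinear Schroedinger equation\<close>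

definition partial_deriv ::
    "'a::euclidean_space \<Rightarrow> ('a \<Rightarrow> complex) \<Rightarrow> 'a \<Rightarrow> complex" where
  "partial_deriv b u x = vector_derivative (\<lambda>h. u (x + h *\<^sub>R b)) (at 0)"

definition laplacian :: "('a::euclidean_space \<Rightarrow> complex) \<Rightarrow> 'a \<Rightarrow> complex" where
  "laplacian u x = (\<Sum>b\<in>Basis. partial_deriv b (partial_deriv b u) x)"

definition bilaplacian :: "('a::euclidean_space \<Rightarrow> complex) \<Rightarrow> 'a \<Rightarrow> complex" where
  "bilaplacian u = laplacian (laplacian u)"

text \<open>All spatial partial derivatives of \<open>\<psi>\<close> up to order \<open>k\<close> exist on \<open>I \<times> \<real>\<^sup>d\<close> and are jointly
  continuous there.\<close>

primrec space_Ck :: "nat \<Rightarrow> real set \<Rightarrow> (real \<Rightarrow> 'a::euclidean_space \<Rightarrow> complex) \<Rightarrow> bool" where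
  "space_Ck 0 I \<psi> \<longleftrightarrow> continuous_on (I \<times> UNIV) (\<lambda>(t, x). \<psi> t x)"
| "space_Ck (Suc k) I \<psi> \<longleftrightarrow>
     continuous_on (I \<times> UNIV) (\<lambda>(t, x). \<psi> t x) \<and>
     (\<forall>b\<in>Basis.
        (\<forall>t\<in>I. \<forall>x. (\<lambda>h. \<psi> t (x + h *\<^sub>R b)) differentiable (at 0)) \<and>
        space_Ck k I (\<lambda>t. partial_deriv b (\<psi> t)))"

text \<open>Classical solutions on \<open>I \<times> \<real>\<^sup>d\<close>; the time derivative is taken within \<open>I\<close>, hence one-sided
  at an endpoint belonging to \<open>I\<close>.\<close>

definition bnls_solution ::
    "real \<Rightarrow> real set \<Rightarrow> (real \<Rightarrow> 'a::euclidean_space \<Rightarrow> complex) \<Rightarrow> bool" where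
  "bnls_solution \<sigma> I \<psi> \<longleftrightarrow>
     space_Ck 4 I \<psi> \<and>
     (\<exists>\<psi>\<^sub>t. continuous_on (I \<times> UNIV) (\<lambda>(t, x). \<psi>\<^sub>t t x) \<and>
       (\<forall>t\<in>I. \<forall>x. ((\<lambda>s. \<psi> s x) has_vector_derivative \<psi>\<^sub>t t x) (at t within I) \<and>
          \<i> * \<psi>\<^sub>t t x - bilaplacian (\<psi> t) x
            + of_real (norm (\<psi> t x) powr (2 * \<sigma>)) * \<psi> t x = 0))"

subsection \<open>The self-similar ansatz\<close>

definition blowup_scale :: "real \<Rightarrow> real \<Rightarrow> real \<Rightarrow> real" where
  "blowup_scale \<kappa> Tc t = \<kappa> * (Tc - t) powr (1 / 4)"

definition self_similar ::
    "real \<Rightarrow> real \<Rightarrow> real \<Rightarrow> real \<Rightarrow> (real \<Rightarrow> complex) \<Rightarrow> real \<Rightarrow> 'a::euclidean_space \<Rightarrow> complex" where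
  "self_similar \<sigma> \<nu> \<kappa> Tc S t x =
     of_real (1 / blowup_scale \<kappa> Tc t powr (2 / \<sigma>))
     * S (norm x / blowup_scale \<kappa> Tc t)
     * exp (\<i> * of_real (\<nu> * integral {0..t} (\<lambda>s. 1 / blowup_scale \<kappa> Tc s ^ 4)))"

end

theory Submission
  imports Defs
begin

text \<open>In the variable \<open>y = x / L(t)\<close> both sides of the equation are multiples of
  \<open>L powr (- 2 / \<sigma> - 4)\<close>, since \<open>L\<^sup>3 L' = - \<kappa>\<^sup>4 / 4\<close>, and what remains is the profile equation at
  \<open>\<rho> = \<bar>y\<bar>\<close>. The analytic point is that \<open>S(\<bar>y\<bar>)\<close> is \<open>C\<^sup>4\<close> across the origin. Its partial
  derivatives are polynomials in \<open>y\<close> times iterates of \<open>(1/r) d/dr\<close> applied to \<open>S\<close>; as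
  \<open>S'(0) = S'''(0) = 0\<close>, Taylor expansion shows that these products extend continuously to \<open>0\<close>, and
  a continuous function whose derivative off a point extends continuously to it is differentiable
  there.\<close>

text \<open>For a profile that is merely C^4, the third and fourth iterates of (1/r) d/dr may blow
  up at 0, as r^4.5 shows; only r^2 and r^4 times them are controlled. This suffices because a
  partial derivative of order k \<le> 4 of S(|y|) carries the j-th iterate with a monomial of degree
  2j - k, which is at least 2 for j = 3 and equals 4 for j = 4. Keeping the derivatives in this
  form, rather than in powers of 1/r, also treats all dimensions at once. A second passage to the
  origin is needed at the end: the profile equation is given for \<rho> > 0 only, whereas the
  evolution equation is claimed at x = 0 as well.\<close>

section \<open>Derivatives and continuity across a removed origin\<close>

text \<open>The fundamental theorem of calculus tolerates one exceptional point, so on [-1, 1]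
  \<open>g\<close> is a constant plus the integral of \<open>w\<close>; continuity of
  \<open>w\<close> at 0 does the rest.\<close>

lemma has_vector_derivative_puncture:
  fixes g w :: "real \<Rightarrow> complex"
  assumes g: "continuous_on UNIV g" and w: "continuous_on UNIV w"
    and deriv: "\<And>h. h \<noteq> 0 \<Longrightarrow> (g has_vector_derivative w h) (at h)"
  shows "(g has_vector_derivative w 0) (at 0)"
proof -
  have cw: "continuous_on {-1..1} w" using w continuous_on_subset by blast
  have gi: "g x = g (-1) + integral {-1..x} w" if "x \<in> {-1..1}" for x
  proof -
    have "(w has_integral (g x - g (-1))) {-1..x}"
      by (rule fundamental_theorem_of_calculus_interior_strong[of "{0}"])
        (use that deriv in \<open>auto intro: continuous_on_subset[OF g]\<close>)
    then show ?thesis by (simp add: integral_unique)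
  qed
  have "((\<lambda>x. g (-1) + integral {-1..x} w) has_vector_derivative w 0) (at 0 within {-1..1})"
    using integral_has_vector_derivative[OF cw, of 0]
    by (auto intro!: derivative_eq_intros)
  then have "(g has_vector_derivative w 0) (at 0 within {-1..1})"
    by (rule has_vector_derivative_transform[OF _ gi, rotated 2]) auto
  then show ?thesis by (simp add: at_within_Icc_at)
qed

text \<open>Off the origin the product is the bounded factor \<open>P x / norm x ^ m\<close> times a
  continuous function of \<open>norm x\<close>. As m > 0, that function is 0 at 0, so hypothesis
  \<open>f\<close> encodes f(r) = o(r^-m) whatever the value \<open>f 0\<close>, and the bounded
  factor preserves the limit 0.\<close>

lemma continuous_radial_term:
  fixes P :: "'a::euclidean_space \<Rightarrow> real" and f :: "real \<Rightarrow> complex"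
  assumes P: "continuous_on UNIV P" and bound: "\<And>x. \<bar>P x\<bar> \<le> norm x ^ m" and m: "m > 0"
    and f: "continuous_on {0..} (\<lambda>r. r ^ m *\<^sub>R f r)"
  shows "continuous_on UNIV (\<lambda>x. P x *\<^sub>R f (norm x))"
proof -
  define h where "h = (\<lambda>r. r ^ m *\<^sub>R f r)"
  have h: "continuous_on UNIV (\<lambda>x::'a. h (norm x))"
    unfolding h_def by (rule continuous_on_compose2[OF f]) (auto intro!: continuous_intros)
  have eq: "P x *\<^sub>R f (norm x) = (P x / norm x ^ m) *\<^sub>R h (norm x)" if "x \<noteq> 0" for x
    using that by (simp add: h_def)
  have "continuous_on (-{0}) (\<lambda>x. (P x / norm x ^ m) *\<^sub>R h (norm x))"
    by (intro continuous_intros continuous_on_subset[OF P] continuous_on_subset[OF h]) auto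
  then have "continuous_on (-{0}) (\<lambda>x. P x *\<^sub>R f (norm x))"
    by (rule continuous_on_eq) (use eq in auto)
  then have away: "isCont (\<lambda>x. P x *\<^sub>R f (norm x)) x" if "x \<noteq> 0" for x
    using that by (simp add: continuous_on_eq_continuous_at open_Compl)
  have P0: "P 0 = 0" using bound[of 0] m by (simp add: zero_power)
  have h0: "((\<lambda>x::'a. h (norm x)) \<longlongrightarrow> 0) (at 0)"
  proof -
    have "isCont (\<lambda>x::'a. h (norm x)) 0" using h by (simp add: continuous_on_eq_continuous_at)
    then show ?thesis using m by (simp add: isCont_def h_def zero_power)
  qed
  have "((\<lambda>x. P x *\<^sub>R f (norm x)) \<longlongrightarrow> 0) (at 0)"
  proof (rule Lim_null_comparison[OF _ tendsto_norm_zero[OF h0]], rule always_eventually, rule allI)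
    fix x show "norm (P x *\<^sub>R f (norm x)) \<le> norm (h (norm x))"
      using mult_right_mono[OF bound[of x], of "norm (f (norm x))"] by (simp add: h_def)
  qed
  then have "isCont (\<lambda>x. P x *\<^sub>R f (norm x)) 0" by (simp add: isCont_def P0)
  with away have "isCont (\<lambda>x. P x *\<^sub>R f (norm x)) x" for x by (cases "x = 0") auto
  then show ?thesis by (simp add: continuous_on_eq_continuous_at)
qed

section \<open>Partial derivatives of a radial function up to order four\<close>

text \<open>\<open>F (Suc j)\<close> stands for \<open>F j ' / r\<close>, so that \<open>\<partial>\<^sub>b (F j \<bar>x\<bar>) = x\<^sub>b F (Suc j) \<bar>x\<bar>\<close>. The values
  \<open>F 3 0\<close> and \<open>F 4 0\<close> are irrelevant.\<close>

locale radial_tower =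
  fixes F :: "nat \<Rightarrow> real \<Rightarrow> complex"
  assumes F_deriv: "\<And>j r. j < 4 \<Longrightarrow> r > 0 \<Longrightarrow>
      (F j has_vector_derivative r *\<^sub>R F (Suc j) r) (at r)"
    and F_cont: "\<And>j. j \<le> 2 \<Longrightarrow> continuous_on {0..} (F j)"
    and F3_cont: "continuous_on {0..} (\<lambda>r. r ^ 2 *\<^sub>R F 3 r)"
    and F4_cont: "continuous_on {0..} (\<lambda>r. r ^ 4 *\<^sub>R F 4 r)"
begin

definition u0 :: "'a::euclidean_space \<Rightarrow> complex" where
  "u0 x = F 0 (norm x)"

definition u1 :: "'a::euclidean_space \<Rightarrow> 'a \<Rightarrow> complex" where
  "u1 a x = (x \<bullet> a) *\<^sub>R F 1 (norm x)"

definition u2 :: "'a::euclidean_space \<Rightarrow> 'a \<Rightarrow> 'a \<Rightarrow> complex" where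
  "u2 a b x = (a \<bullet> b) *\<^sub>R F 1 (norm x) + ((x \<bullet> a) * (x \<bullet> b)) *\<^sub>R F 2 (norm x)"

definition u3 :: "'a::euclidean_space \<Rightarrow> 'a \<Rightarrow> 'a \<Rightarrow> 'a \<Rightarrow> complex" where
  "u3 a b c x = ((a \<bullet> b) * (x \<bullet> c) + (a \<bullet> c) * (x \<bullet> b) + (b \<bullet> c) * (x \<bullet> a)) *\<^sub>R F 2 (norm x)
     + ((x \<bullet> a) * (x \<bullet> b) * (x \<bullet> c)) *\<^sub>R F 3 (norm x)"

text \<open>The summands are the partial matchings of the four directions: a matched pair
  contributes its inner product, an unmatched direction its component of \<open>x\<close>, and the
  index of \<open>F\<close> counts pairs plus unmatched directions. Hence three terms with
  \<open>F 2\<close>, six with \<open>F 3\<close>, one with \<open>F 4\<close>; \<open>u1\<close> to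
  \<open>u3\<close> follow the same pattern.\<close>

definition u4 :: "'a::euclidean_space \<Rightarrow> 'a \<Rightarrow> 'a \<Rightarrow> 'a \<Rightarrow> 'a \<Rightarrow> complex" where
  "u4 a b c d x =
     ((a \<bullet> b) * (c \<bullet> d) + (a \<bullet> c) * (b \<bullet> d) + (b \<bullet> c) * (a \<bullet> d)) *\<^sub>R F 2 (norm x)
     + ((a \<bullet> b) * (x \<bullet> c) * (x \<bullet> d) + (a \<bullet> c) * (x \<bullet> b) * (x \<bullet> d) + (b \<bullet> c) * (x \<bullet> a) * (x \<bullet> d)
        + (a \<bullet> d) * (x \<bullet> b) * (x \<bullet> c) + (b \<bullet> d) * (x \<bullet> a) * (x \<bullet> c) + (c \<bullet> d) * (x \<bullet> a) * (x \<bullet> b))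
       *\<^sub>R F 3 (norm x)
     + ((x \<bullet> a) * (x \<bullet> b) * (x \<bullet> c) * (x \<bullet> d)) *\<^sub>R F 4 (norm x)"

lemma continuous_F_norm:
  "j \<le> 2 \<Longrightarrow> continuous_on UNIV (\<lambda>x::'a::euclidean_space. F j (norm x))"
  by (rule continuous_on_compose2[OF F_cont]) (auto intro!: continuous_intros)

lemma continuous_F3_norm:
  fixes a b :: "'a::euclidean_space"
  assumes "a \<in> Basis" "b \<in> Basis"
  shows "continuous_on UNIV (\<lambda>x. ((x \<bullet> a) * (x \<bullet> b)) *\<^sub>R F 3 (norm x))"
proof (rule continuous_radial_term[OF _ _ _ F3_cont])
  show "\<bar>(x \<bullet> a) * (x \<bullet> b)\<bar> \<le> norm x ^ 2" for x
    unfolding abs_mult power2_eq_square by (intro mult_mono Basis_le_norm assms) auto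
qed (auto intro!: continuous_intros)

lemma continuous_F4_norm:
  fixes a b c d :: "'a::euclidean_space"
  assumes "a \<in> Basis" "b \<in> Basis" "c \<in> Basis" "d \<in> Basis"
  shows "continuous_on UNIV (\<lambda>x. ((x \<bullet> a) * (x \<bullet> b) * (x \<bullet> c) * (x \<bullet> d)) *\<^sub>R F 4 (norm x))"
proof (rule continuous_radial_term[OF _ _ _ F4_cont])
  have e: "z ^ 4 = z * z * z * z" for z :: real by (simp add: power4_eq_xxxx)
  show "\<bar>(x \<bullet> a) * (x \<bullet> b) * (x \<bullet> c) * (x \<bullet> d)\<bar> \<le> norm x ^ 4" for x
    unfolding abs_mult e by (intro mult_mono Basis_le_norm assms) auto
qed (auto intro!: continuous_intros)

lemma continuous_u0: "continuous_on UNIV (u0 :: 'a::euclidean_space \<Rightarrow> complex)"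
  unfolding u0_def by (intro continuous_F_norm) simp

lemma continuous_u1: "continuous_on UNIV (u1 a)"
  unfolding u1_def by (intro continuous_intros continuous_F_norm) simp

lemma continuous_u2: "continuous_on UNIV (u2 a b)"
  unfolding u2_def by (intro continuous_intros continuous_F_norm) simp_all

lemma continuous_u3:
  assumes "a \<in> Basis" "b \<in> Basis"
  shows "continuous_on UNIV (u3 a b c)"
proof -
  \<comment> \<open>Two coordinates absorb the singularity of \<open>F 3\<close>; the third is an
    ordinary continuous factor, which is why \<open>c\<close> may be any vector.\<close>
  have eq: "u3 a b c = (\<lambda>x. ((a \<bullet> b) * (x \<bullet> c) + (a \<bullet> c) * (x \<bullet> b) + (b \<bullet> c) * (x \<bullet> a)) *\<^sub>R F 2 (norm x)
     + (x \<bullet> c) *\<^sub>R ((x \<bullet> a) * (x \<bullet> b)) *\<^sub>R F 3 (norm x))"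
    by (rule ext) (simp only: u3_def scaleR_scaleR mult_ac)
  show ?thesis unfolding eq
    by (intro continuous_on_add continuous_on_scaleR continuous_F_norm continuous_F3_norm assms
        continuous_intros) auto
qed

lemma continuous_u4:
  assumes "a \<in> Basis" "b \<in> Basis" "c \<in> Basis" "d \<in> Basis"
  shows "continuous_on UNIV (u4 a b c d)"
proof -
  \<comment> \<open>Each \<open>F 3\<close> term carries exactly two coordinates, the degree that
    \<open>continuous_F3_norm\<close> asks for.\<close>
  have eq: "u4 a b c d = (\<lambda>x.
     ((a \<bullet> b) * (c \<bullet> d) + (a \<bullet> c) * (b \<bullet> d) + (b \<bullet> c) * (a \<bullet> d)) *\<^sub>R F 2 (norm x)
     + ((a \<bullet> b) *\<^sub>R (((x \<bullet> c) * (x \<bullet> d)) *\<^sub>R F 3 (norm x))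
      + (a \<bullet> c) *\<^sub>R (((x \<bullet> b) * (x \<bullet> d)) *\<^sub>R F 3 (norm x))
      + (b \<bullet> c) *\<^sub>R (((x \<bullet> a) * (x \<bullet> d)) *\<^sub>R F 3 (norm x))
      + (a \<bullet> d) *\<^sub>R (((x \<bullet> b) * (x \<bullet> c)) *\<^sub>R F 3 (norm x))
      + (b \<bullet> d) *\<^sub>R (((x \<bullet> a) * (x \<bullet> c)) *\<^sub>R F 3 (norm x))
      + (c \<bullet> d) *\<^sub>R (((x \<bullet> a) * (x \<bullet> b)) *\<^sub>R F 3 (norm x)))
     + ((x \<bullet> a) * (x \<bullet> b) * (x \<bullet> c) * (x \<bullet> d)) *\<^sub>R F 4 (norm x))"
    by (rule ext) (simp only: u4_def scaleR_add_left scaleR_scaleR mult.assoc)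
  show ?thesis unfolding eq
    by (intro continuous_on_add continuous_on_scaleR[OF continuous_on_const] continuous_F_norm
        continuous_F3_norm continuous_F4_norm assms) auto
qed

lemma inner_line_deriv:
  "((\<lambda>h. (x + h *\<^sub>R c) \<bullet> a) has_real_derivative a \<bullet> c) (at 0)"
  by (auto simp: inner_add_left inner_commute[of c] intro!: derivative_eq_intros)

text \<open>The norm has directional derivative (x \<bullet> b) / norm x, and its denominator
  cancels against the factor \<open>r\<close> in \<open>F_deriv\<close>.\<close>

lemma F_norm_deriv:
  fixes x b :: "'a::euclidean_space"
  assumes x: "x \<noteq> 0" and j: "j < 4"
  shows "((\<lambda>h. F j (norm (x + h *\<^sub>R b))) has_vector_derivative (x \<bullet> b) *\<^sub>R F (Suc j) (norm x)) (at 0)"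
proof -
  have "((\<lambda>h. x + h *\<^sub>R b) has_derivative (\<lambda>h. h *\<^sub>R b)) (at 0)"
    by (auto intro!: derivative_eq_intros)
  from has_derivative_compose[OF this, of norm "\<lambda>v. v \<bullet> sgn x"] has_derivative_norm[OF x]
  have "((\<lambda>h. norm (x + h *\<^sub>R b)) has_derivative (\<lambda>h. (x \<bullet> b) / norm x * h)) (at 0)"
    by (simp add: sgn_div_norm inner_commute divide_inverse mult_ac)
  then have "((\<lambda>h. norm (x + h *\<^sub>R b)) has_vector_derivative (x \<bullet> b) / norm x) (at 0)"
    by (simp only: has_real_derivative_iff_has_vector_derivative[symmetric] has_field_derivative_def)
  from vector_diff_chain_at[OF this, of "F j" "norm x *\<^sub>R F (Suc j) (norm x)"]
  show ?thesis using F_deriv[OF j, of "norm x"] x by (simp add: o_def)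
qed

lemma term_deriv:
  fixes x b :: "'a::euclidean_space"
  assumes "x \<noteq> 0" "j < 4"
    and "((\<lambda>h. P (x + h *\<^sub>R b)) has_real_derivative P') (at 0)"
  shows "((\<lambda>h. P (x + h *\<^sub>R b) *\<^sub>R F j (norm (x + h *\<^sub>R b))) has_vector_derivative
      P' *\<^sub>R F j (norm x) + (P x * (x \<bullet> b)) *\<^sub>R F (Suc j) (norm x)) (at 0)"
  using has_vector_derivative_scaleR[OF assms(3) F_norm_deriv[OF assms(1,2)]]
  by (simp add: add.commute)

text \<open>On the line spanned by \<open>b\<close> only the parameter 0 meets the origin, so at x =
  0 the claim is \<open>has_vector_derivative_puncture\<close> for \<open>u\<close> restricted to
  that line.\<close>

lemma partial_puncture:
  fixes u v :: "'a::euclidean_space \<Rightarrow> complex"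
  assumes u: "continuous_on UNIV u" and v: "continuous_on UNIV v" and b: "b \<in> Basis"
    and deriv: "\<And>x. x \<noteq> 0 \<Longrightarrow> ((\<lambda>h. u (x + h *\<^sub>R b)) has_vector_derivative v x) (at 0)"
  shows "((\<lambda>h. u (x + h *\<^sub>R b)) has_vector_derivative v x) (at 0)"
proof (cases "x = 0")
  case True
  have "((\<lambda>h. u (h *\<^sub>R b)) has_vector_derivative v (0 *\<^sub>R b)) (at 0)"
  proof (rule has_vector_derivative_puncture[where w = "\<lambda>h. v (h *\<^sub>R b)"])
    show "continuous_on UNIV (\<lambda>h. u (h *\<^sub>R b))" "continuous_on UNIV (\<lambda>h. v (h *\<^sub>R b))"
      by (auto intro!: continuous_on_compose2[OF u] continuous_on_compose2[OF v] continuous_intros)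
    fix h :: real assume "h \<noteq> 0"
    then have "h *\<^sub>R b \<noteq> 0" using b by auto
    from deriv[OF this]
    \<comment> \<open>The base point stays in the form \<open>h - h\<close>, the value of the shift
      \<open>k - h\<close> at \<open>k = h\<close>, as the chain rule expects it.\<close>
    have *: "((\<lambda>k. u (h *\<^sub>R b + k *\<^sub>R b)) has_vector_derivative v (h *\<^sub>R b)) (at (h - h))" by simp
    have "((\<lambda>k. k - h) has_vector_derivative 1) (at h)"
      by (auto intro!: derivative_eq_intros)
    from vector_diff_chain_at[OF this *]
    show "((\<lambda>h. u (h *\<^sub>R b)) has_vector_derivative v (h *\<^sub>R b)) (at h)"
      by (simp add: o_def scaleR_add_left[symmetric])
  qed
  then show ?thesis using True by simp
qed (use deriv in auto)

lemma deriv_u0: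
  assumes "b \<in> Basis"
  shows "((\<lambda>h. u0 (x + h *\<^sub>R b)) has_vector_derivative u1 b x) (at 0)"
  by (rule partial_puncture[OF continuous_u0 continuous_u1 assms])
    (use F_norm_deriv[of _ 0] in \<open>simp add: u0_def u1_def\<close>)

lemma deriv_u1:
  assumes "b \<in> Basis"
  shows "((\<lambda>h. u1 a (x + h *\<^sub>R b)) has_vector_derivative u2 a b x) (at 0)"
proof (rule partial_puncture[OF continuous_u1 continuous_u2 assms])
  fix x :: 'a assume "x \<noteq> 0"
  from term_deriv[OF this _ inner_line_deriv, where j = 1]
  show "((\<lambda>h. u1 a (x + h *\<^sub>R b)) has_vector_derivative u2 a b x) (at 0)"
    unfolding u1_def u2_def
    by (simp add: numeral_2_eq_2)
qed

lemma deriv_u2: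
  assumes "a \<in> Basis" "b \<in> Basis" "c \<in> Basis"
  shows "((\<lambda>h. u2 a b (x + h *\<^sub>R c)) has_vector_derivative u3 a b c x) (at 0)"
proof (rule partial_puncture[OF continuous_u2 continuous_u3 assms(3)])
  fix x :: 'a assume x: "x \<noteq> 0"
  have s: "Suc 1 = 2" "Suc 2 = 3" by simp_all
  have 1: "((\<lambda>h. (a \<bullet> b) *\<^sub>R F 1 (norm (x + h *\<^sub>R c))) has_vector_derivative
      0 *\<^sub>R F 1 (norm x) + ((a \<bullet> b) * (x \<bullet> c)) *\<^sub>R F (Suc 1) (norm x)) (at 0)"
    by (rule term_deriv[OF x, where P = "\<lambda>_. a \<bullet> b"]) simp_all
  have 2: "((\<lambda>h. (((x + h *\<^sub>R c) \<bullet> a) * ((x + h *\<^sub>R c) \<bullet> b)) *\<^sub>R F 2 (norm (x + h *\<^sub>R c)))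
      has_vector_derivative ((a \<bullet> c) * (x \<bullet> b) + (b \<bullet> c) * (x \<bullet> a)) *\<^sub>R F 2 (norm x)
        + (((x \<bullet> a) * (x \<bullet> b)) * (x \<bullet> c)) *\<^sub>R F (Suc 2) (norm x)) (at 0)"
    by (rule term_deriv[OF x, where P = "\<lambda>x. (x \<bullet> a) * (x \<bullet> b)"], simp)
      (rule DERIV_cong[OF DERIV_mult[OF inner_line_deriv inner_line_deriv]], simp)
  show "((\<lambda>h. u2 a b (x + h *\<^sub>R c)) has_vector_derivative u3 a b c x) (at 0)"
    unfolding u2_def u3_def
    by (rule has_vector_derivative_eq_rhs[OF has_vector_derivative_add[OF 1 2]])
      (simp only: s scaleR_zero_left add_0_left scaleR_add_left add_ac)
qed (fact assms)+

lemma deriv_u3: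
  assumes "a \<in> Basis" "b \<in> Basis" "c \<in> Basis" "d \<in> Basis"
  shows "((\<lambda>h. u3 a b c (x + h *\<^sub>R d)) has_vector_derivative u4 a b c d x) (at 0)"
proof (rule partial_puncture[OF continuous_u3 continuous_u4 assms(4)])
  fix x :: 'a assume x: "x \<noteq> 0"
  let ?P = "\<lambda>x. (a \<bullet> b) * (x \<bullet> c) + (a \<bullet> c) * (x \<bullet> b) + (b \<bullet> c) * (x \<bullet> a)"
  let ?Q = "\<lambda>x. (x \<bullet> a) * (x \<bullet> b) * (x \<bullet> c)"
  have 1: "((\<lambda>h. ?P (x + h *\<^sub>R d) *\<^sub>R F 2 (norm (x + h *\<^sub>R d))) has_vector_derivative
      ((a \<bullet> b) * (c \<bullet> d) + (a \<bullet> c) * (b \<bullet> d) + (b \<bullet> c) * (a \<bullet> d)) *\<^sub>R F 2 (norm x)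
        + (?P x * (x \<bullet> d)) *\<^sub>R F (Suc 2) (norm x)) (at 0)"
    by (rule term_deriv[OF x, where P = ?P], simp)
      (intro DERIV_add DERIV_cmult inner_line_deriv)
  have 2: "((\<lambda>h. ?Q (x + h *\<^sub>R d) *\<^sub>R F 3 (norm (x + h *\<^sub>R d))) has_vector_derivative
      ((a \<bullet> d) * (x \<bullet> b) * (x \<bullet> c) + (b \<bullet> d) * (x \<bullet> a) * (x \<bullet> c) + (c \<bullet> d) * (x \<bullet> a) * (x \<bullet> b)) *\<^sub>R F 3 (norm x)
        + (?Q x * (x \<bullet> d)) *\<^sub>R F (Suc 3) (norm x)) (at 0)"
    by (rule term_deriv[OF x, where P = ?Q], simp)
      (rule DERIV_cong[OF DERIV_mult[OF DERIV_mult[OF inner_line_deriv inner_line_deriv] inner_line_deriv]],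
        simp add: algebra_simps)
  have s: "Suc 2 = 3" "Suc 3 = 4" by simp_all
  show "((\<lambda>h. u3 a b c (x + h *\<^sub>R d)) has_vector_derivative u4 a b c d x) (at 0)"
    unfolding u3_def u4_def
    by (rule has_vector_derivative_eq_rhs[OF has_vector_derivative_add[OF 1 2]])
      (simp only: s distrib_right scaleR_add_left mult.assoc add_ac)
qed (fact assms)+

lemma partial_u0: "b \<in> Basis \<Longrightarrow> partial_deriv b u0 = u1 b"
  by (simp add: fun_eq_iff partial_deriv_def vector_derivative_at[OF deriv_u0])

lemma partial_u1: "b \<in> Basis \<Longrightarrow> partial_deriv b (u1 a) = u2 a b"
  by (simp add: fun_eq_iff partial_deriv_def vector_derivative_at[OF deriv_u1])

lemma partial_u2:
  "\<lbrakk>a \<in> Basis; b \<in> Basis; c \<in> Basis\<rbrakk> \<Longrightarrow> partial_deriv c (u2 a b) = u3 a b c"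
  by (simp add: fun_eq_iff partial_deriv_def vector_derivative_at[OF deriv_u2])

lemma partial_u3:
  "\<lbrakk>a \<in> Basis; b \<in> Basis; c \<in> Basis; d \<in> Basis\<rbrakk> \<Longrightarrow> partial_deriv d (u3 a b c) = u4 a b c d"
  by (simp add: fun_eq_iff partial_deriv_def vector_derivative_at[OF deriv_u3])

lemma continuous_static:
  fixes f :: "'a::euclidean_space \<Rightarrow> complex"
  shows "continuous_on UNIV f \<Longrightarrow> continuous_on (UNIV \<times> UNIV) (\<lambda>(t::real, x). f x)"
  unfolding case_prod_beta by (rule continuous_on_compose2[of UNIV f]) (auto intro!: continuous_intros)

lemma space_C4_u0: "space_Ck 4 UNIV (\<lambda>_. u0 :: 'a::euclidean_space \<Rightarrow> complex)"
proof -
  have four: "4 = Suc (Suc (Suc (Suc 0)))" by simp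
  note d = deriv_u0 deriv_u1 deriv_u2 deriv_u3
  show ?thesis
    unfolding four space_Ck.simps
    by (auto simp del: UNIV_Times_UNIV simp: partial_u0 partial_u1 partial_u2 partial_u3
        intro!: continuous_static continuous_u0 continuous_u1 continuous_u2 continuous_u3 continuous_u4
          d[THEN differentiableI_vector])
qed

lemma bilaplacian_u0_sum:
  "bilaplacian u0 x = (\<Sum>b\<in>Basis. \<Sum>a\<in>Basis. u4 a a b b (x::'a::euclidean_space))"
proof -
  have lap: "laplacian (u0 :: 'a \<Rightarrow> complex) = (\<lambda>x. \<Sum>a\<in>Basis. u2 a a x)"
    by (simp add: fun_eq_iff laplacian_def partial_u0 partial_u1)
  have 1: "partial_deriv b (\<lambda>x. \<Sum>a\<in>Basis. u2 a a x) = (\<lambda>x::'a. \<Sum>a\<in>Basis. u3 a a b x)"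
    if "b \<in> Basis" for b
    unfolding partial_deriv_def
    by (intro ext vector_derivative_at has_vector_derivative_sum deriv_u2 that)
  have 2: "partial_deriv b (\<lambda>x. \<Sum>a\<in>Basis. u3 a a b x) = (\<lambda>x::'a. \<Sum>a\<in>Basis. u4 a a b b x)"
    if "b \<in> Basis" for b
    unfolding partial_deriv_def
    by (intro ext vector_derivative_at has_vector_derivative_sum deriv_u3 that)
  show ?thesis unfolding bilaplacian_def lap laplacian_def
    by (intro sum.cong refl) (simp add: 1 2)
qed

lemma continuous_bilaplacian_u0:
  "continuous_on UNIV (bilaplacian (u0 :: 'a::euclidean_space \<Rightarrow> complex))"
  unfolding bilaplacian_u0_sum[abs_def] by (intro continuous_intros continuous_u4)

text \<open>Contraction of \<open>u4 a a b b\<close> over both indices. With \<open>F 2\<close>, the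
  matching of equal indices gives D^2 and the other two give D each. With \<open>F 3\<close>, the
  pairs (a,a) and (b,b) give D r^2 each and the four mixed pairs r^2 each.\<close>

lemma bilaplacian_u0:
  fixes x :: "'a::euclidean_space"
  defines "D \<equiv> real DIM('a)" and "r \<equiv> norm x"
  shows "bilaplacian u0 x = (D\<^sup>2 + 2 * D) *\<^sub>R F 2 r + ((2 * D + 4) * r\<^sup>2) *\<^sub>R F 3 r + r ^ 4 *\<^sub>R F 4 r"
proof -
  have sq: "(\<Sum>a\<in>Basis. (x \<bullet> a) * (x \<bullet> a)) = r\<^sup>2"
    unfolding r_def power2_norm_eq_inner by (rule euclidean_inner[symmetric])
  have delta: "(\<Sum>a\<in>Basis. (a \<bullet> b) * f a) = f b" if "b \<in> Basis" for b :: 'a and f :: "'a \<Rightarrow> real"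
    using that by (simp add: inner_Basis if_distrib[of "\<lambda>z. z * _"] sum.delta cong: if_cong)
  have inner: "(\<Sum>a\<in>Basis. u4 a a b b x) =
      (D + 2) *\<^sub>R F 2 r + (r\<^sup>2 + (D + 4) * (x \<bullet> b)\<^sup>2) *\<^sub>R F 3 r + (r\<^sup>2 * (x \<bullet> b)\<^sup>2) *\<^sub>R F 4 r"
    if b: "b \<in> Basis" for b
  proof -
    \<comment> \<open>Arranged with a factor \<open>a \<bullet> b\<close> in front, so that
      \<open>delta\<close> collapses the sums over \<open>a\<close>.\<close>
    have term_eq: "u4 a a b b x = (1 + 2 * ((a \<bullet> b) * (a \<bullet> b))) *\<^sub>R F 2 r
        + ((x \<bullet> b)\<^sup>2 + 4 * ((a \<bullet> b) * ((x \<bullet> a) * (x \<bullet> b))) + (x \<bullet> a) * (x \<bullet> a)) *\<^sub>R F 3 r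
        + (((x \<bullet> a) * (x \<bullet> a)) * (x \<bullet> b)\<^sup>2) *\<^sub>R F 4 r" if "a \<in> Basis" for a
      using b that by (simp add: u4_def r_def inner_same_Basis power2_eq_square algebra_simps)
    have "(\<Sum>a\<in>Basis. u4 a a b b x) =
      (\<Sum>a\<in>Basis. 1 + 2 * ((a \<bullet> b) * (a \<bullet> b))) *\<^sub>R F 2 r
      + (\<Sum>a\<in>Basis. (x \<bullet> b)\<^sup>2 + 4 * ((a \<bullet> b) * ((x \<bullet> a) * (x \<bullet> b))) + (x \<bullet> a) * (x \<bullet> a)) *\<^sub>R F 3 r
      + (\<Sum>a\<in>Basis. ((x \<bullet> a) * (x \<bullet> a)) * (x \<bullet> b)\<^sup>2) *\<^sub>R F 4 r"
      unfolding scaleR_sum_left sum.distrib[symmetric]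
      by (rule sum.cong) (simp_all only: term_eq)
    also have "\<dots> = (D + 2) *\<^sub>R F 2 r + (r\<^sup>2 + (D + 4) * (x \<bullet> b)\<^sup>2) *\<^sub>R F 3 r + (r\<^sup>2 * (x \<bullet> b)\<^sup>2) *\<^sub>R F 4 r"
      unfolding sum_distrib_right[symmetric] sq
      using b by (simp add: sum.distrib sum_distrib_left[symmetric] delta sq D_def
          power2_eq_square algebra_simps)
    finally show ?thesis .
  qed
  have sq': "(\<Sum>b\<in>Basis. (x \<bullet> b)\<^sup>2) = r\<^sup>2" using sq by (simp add: power2_eq_square)
  have "bilaplacian u0 x = (\<Sum>b\<in>Basis.
      (D + 2) *\<^sub>R F 2 r + (r\<^sup>2 + (D + 4) * (x \<bullet> b)\<^sup>2) *\<^sub>R F 3 r + (r\<^sup>2 * (x \<bullet> b)\<^sup>2) *\<^sub>R F 4 r)"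
    unfolding bilaplacian_u0_sum by (intro sum.cong refl inner)
  also have "\<dots> = (D * (D + 2)) *\<^sub>R F 2 r + (D * r\<^sup>2 + (D + 4) * r\<^sup>2) *\<^sub>R F 3 r + (r\<^sup>2 * r\<^sup>2) *\<^sub>R F 4 r"
    by (simp add: sum.distrib scaleR_sum_left[symmetric] sum_distrib_left[symmetric] sq' D_def)
      (simp add: scaleR_conv_of_real mult_ac)
  also have "\<dots> = (D\<^sup>2 + 2 * D) *\<^sub>R F 2 r + ((2 * D + 4) * r\<^sup>2) *\<^sub>R F 3 r + r ^ 4 *\<^sub>R F 4 r"
    by (simp add: power2_eq_square power4_eq_xxxx algebra_simps)
  finally show ?thesis .
qed

end

section \<open>Taylor expansion of the profile at the origin\<close>

text \<open>Integration turns g' = o(r^n) into g = o(r^(n+1)). The mean value inequality is used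
  because the mean value theorem with equality fails for complex values.\<close>

lemma slope_tendsto_zero:
  fixes g g' :: "real \<Rightarrow> complex"
  assumes g: "continuous_on {0..} g" "g 0 = 0"
    and deriv: "\<And>r. r > 0 \<Longrightarrow> (g has_vector_derivative g' r) (at r)"
    and g': "((\<lambda>r. (1 / r ^ n) *\<^sub>R g' r) \<longlongrightarrow> 0) (at_right 0)"
  shows "((\<lambda>r. (1 / r ^ Suc n) *\<^sub>R g r) \<longlongrightarrow> 0) (at_right 0)"
proof (rule tendstoI)
  fix e :: real assume e: "e > 0"
  \<comment> \<open>Half of \<open>e\<close> leaves room for a strict inequality at the end, as the
    mean value inequality only yields \<le>.\<close>
  have "\<forall>\<^sub>F r in at_right 0. dist ((1 / r ^ n) *\<^sub>R g' r) 0 < e / 2"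
    using g' e by (intro tendstoD) auto
  then obtain \<delta> where \<delta>: "\<delta> > 0"
    and small: "\<And>r. 0 < r \<Longrightarrow> r < \<delta> \<Longrightarrow> norm ((1 / r ^ n) *\<^sub>R g' r) < e / 2"
    unfolding eventually_at_right_field by (auto simp: dist_norm)
  have "dist ((1 / r ^ Suc n) *\<^sub>R g r) 0 < e" if r: "0 < r" "r < \<delta>" for r
  proof -
    have "norm (g r - g 0) \<le> (e / 2 * r ^ n) * r - (e / 2 * r ^ n) * 0"
    proof (rule differentiable_bound_general[where a = 0 and b = r and f = g and \<phi> = "\<lambda>t. (e / 2 * r ^ n) * t" and \<phi>' = "\<lambda>_. e / 2 * r ^ n" and f' = g'])
      show "continuous_on {0..r} g" by (rule continuous_on_subset[OF g(1)]) auto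
      fix x assume x: "0 < x" "x < r"
      show "(g has_vector_derivative g' x) (at x)" using deriv x by simp
      have "norm (g' x) \<le> e / 2 * x ^ n"
        using small[of x] x r by (simp add: field_simps)
      also have "\<dots> \<le> e / 2 * r ^ n" using x e by (intro mult_left_mono power_mono) auto
      finally show "norm (g' x) \<le> e / 2 * r ^ n" .
      show "((\<lambda>t. (e / 2 * r ^ n) * t) has_vector_derivative e / 2 * r ^ n) (at x)"
        by (auto intro!: derivative_eq_intros)
    qed (use r in \<open>auto intro!: continuous_intros\<close>)
    then have "norm (g r) \<le> e / 2 * r ^ Suc n" using g by (simp add: mult_ac)
    then have "norm ((1 / r ^ Suc n) *\<^sub>R g r) \<le> e / 2"
      using r by (simp add: field_simps)
    then have "norm ((1 / r ^ Suc n) *\<^sub>R g r) < e" using e by linarith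
    then show ?thesis by (simp only: dist_norm diff_zero)
  qed
  then show "\<forall>\<^sub>F r in at_right 0. dist ((1 / r ^ Suc n) *\<^sub>R g r) 0 < e"
    unfolding eventually_at_right_field using \<delta> by blast
qed

lemma continuous_on_halflineI:
  fixes f :: "real \<Rightarrow> complex"
  assumes "continuous_on {0<..} f" "(f \<longlongrightarrow> f 0) (at_right 0)"
  shows "continuous_on {0..} f"
proof -
  have "continuous (at x within {0..}) f" if "x \<ge> 0" for x
  proof (cases "x = 0")
    case True
    have "at 0 within {0..} = at_right (0::real)"
      by (rule at_within_Ici_at_right)
    then show ?thesis using assms(2) True by (simp add: continuous_within)
  next
    case False
    then have "isCont f x" using assms(1) that by (simp add: continuous_on_eq_continuous_at)
    then show ?thesis by (rule continuous_at_imp_continuous_at_within)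
  qed
  then show ?thesis by (simp add: continuous_on_eq_continuous_within)
qed

text \<open>Vanishing of the first and third derivatives at 0 is exactly the condition for the even
  reflection of \<open>S 0\<close> to be C^4, hence the name. \<open>S j\<close> is to be the j-th
  one-sided derivative.\<close>

locale even_C4 =
  fixes S :: "nat \<Rightarrow> real \<Rightarrow> complex"
  assumes S_deriv: "\<And>j r. j < 4 \<Longrightarrow> r \<ge> 0 \<Longrightarrow> (S j has_vector_derivative S (Suc j) r) (at r within {0..})"
    and S4_cont: "continuous_on {0..} (S 4)"
    and S1_0: "S 1 0 = 0" and S3_0: "S 3 0 = 0"
begin

lemma S_deriv_at:
  assumes "j < 4" "r > 0"
  shows "(S j has_vector_derivative S (Suc j) r) (at r)"
  using S_deriv[OF assms(1), of r] assms(2) by (simp add: at_within_interior[of r "{0..}"])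

lemma S_cont:
  assumes "j \<le> 4"
  shows "continuous_on {0..} (S j)"
proof (cases "j = 4")
  case False
  then show ?thesis using assms S_deriv[of j]
    by (auto simp: continuous_on_eq_continuous_within intro!: has_vector_derivative_continuous)
qed (use S4_cont in simp)

text \<open>\<open>R k\<close> is the \<open>k\<close>-th derivative of the Taylor remainder of \<open>S 1\<close> at \<open>0\<close>.\<close>

definition R :: "nat \<Rightarrow> real \<Rightarrow> complex" where
  "R k r = (if k = 0 then S 1 r - r *\<^sub>R S 2 0 - (r ^ 3 / 6) *\<^sub>R S 4 0
    else if k = 1 then S 2 r - S 2 0 - (r\<^sup>2 / 2) *\<^sub>R S 4 0
    else if k = 2 then S 3 r - r *\<^sub>R S 4 0
    else S 4 r - S 4 0)"

lemma R_deriv: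
  assumes k: "k \<le> 2" and r: "r > 0"
  shows "(R k has_vector_derivative R (Suc k) r) (at r)"
proof -
  have p: "((\<lambda>r. p r *\<^sub>R c) has_vector_derivative p' *\<^sub>R c) (at r)"
    if "(p has_real_derivative p') (at r)" for p p' and c :: complex
    using has_vector_derivative_scaleR[OF that has_vector_derivative_const] by simp
  consider "k = 0" | "k = 1" | "k = 2" using k by linarith
  then show ?thesis
  proof cases
    case 1
    have "((\<lambda>r. S 1 r - r *\<^sub>R S 2 0 - (r ^ 3 / 6) *\<^sub>R S 4 0) has_vector_derivative
        S 2 r - 1 *\<^sub>R S 2 0 - (r\<^sup>2 / 2) *\<^sub>R S 4 0) (at r)"
      using S_deriv_at[of 1 r] r
      by (intro has_vector_derivative_diff p) (auto intro!: derivative_eq_intros simp: numeral_2_eq_2)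
    then show ?thesis using 1 by (simp add: R_def[abs_def])
  next
    case 2
    have "((\<lambda>r. S 2 r - S 2 0 - (r\<^sup>2 / 2) *\<^sub>R S 4 0) has_vector_derivative
        S 3 r - 0 - r *\<^sub>R S 4 0) (at r)"
      using S_deriv_at[of 2 r] r
      by (intro has_vector_derivative_diff p has_vector_derivative_const)
        (auto intro!: derivative_eq_intros simp: eval_nat_numeral)
    then show ?thesis using 2 by (simp add: R_def[abs_def] numeral_2_eq_2)
  next
    case 3
    have "((\<lambda>r. S 3 r - r *\<^sub>R S 4 0) has_vector_derivative S 4 r - 1 *\<^sub>R S 4 0) (at r)"
      using S_deriv_at[of 3 r] r
      by (intro has_vector_derivative_diff p) (auto intro!: derivative_eq_intros simp: eval_nat_numeral)
    then show ?thesis using 3 by (simp add: R_def[abs_def])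
  qed
qed

lemma R_cont: "continuous_on {0..} (R k)"
  unfolding R_def[abs_def]
  by (cases "k = 0"; cases "k = 1"; cases "k = 2") (auto intro!: continuous_intros S_cont)

text \<open>The boundary conditions enter here: the constant and quadratic Taylor coefficients of
  \<open>S 1\<close> are \<open>S 1 0\<close> and half of \<open>S 3 0\<close>, so the subtracted
  polynomial needs odd powers only.\<close>

lemma R_0: "R k 0 = 0"
  using S1_0 S3_0 by (simp add: R_def)

text \<open>Descending induction on \<open>k\<close>: continuity of \<open>S 4\<close> settles
  \<open>R 3\<close>, and each step down gains one power of r through
  \<open>slope_tendsto_zero\<close>.\<close>

lemma R_small: "k \<le> 3 \<Longrightarrow> ((\<lambda>r. (1 / r ^ (3 - k)) *\<^sub>R R k r) \<longlongrightarrow> 0) (at_right 0)"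
proof (induction "3 - k" arbitrary: k)
  case 0
  then have "k = 3" by simp
  have "(R 3 \<longlongrightarrow> R 3 0) (at 0 within {0..})"
    using R_cont[of 3] by (simp add: continuous_on_def)
  then have "(R 3 \<longlongrightarrow> 0) (at_right 0)"
    by (metis R_0 tendsto_within_subset atLeast_iff greaterThan_iff less_imp_le subsetI)
  then show ?case using \<open>k = 3\<close> by simp
next
  case (Suc n)
  then have n: "3 - Suc k = n" "3 - k = Suc n" "k \<le> 2" by auto
  have "((\<lambda>r. (1 / r ^ n) *\<^sub>R R (Suc k) r) \<longlongrightarrow> 0) (at_right 0)"
    using Suc.hyps(1)[of "Suc k"] n by simp
  then show ?case unfolding n(2)
    by (rule slope_tendsto_zero[OF R_cont R_0 R_deriv, rotated -1]) (use n in auto)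
qed

text \<open>\<open>T (Suc j) r = T j ' r / r\<close>, and \<open>T 1 0\<close>, \<open>T 2 0\<close> are the limits at \<open>0\<close>.\<close>

definition T :: "nat \<Rightarrow> real \<Rightarrow> complex" where
  "T j r = (if j = 0 then S 0 r
    else if j = 1 then (if r = 0 then S 2 0 else (1 / r) *\<^sub>R S 1 r)
    else if j = 2 then (if r = 0 then (1 / 3) *\<^sub>R S 4 0 else (1 / r ^ 2) *\<^sub>R S 2 r - (1 / r ^ 3) *\<^sub>R S 1 r)
    else if j = 3 then (1 / r ^ 3) *\<^sub>R S 3 r - (3 / r ^ 4) *\<^sub>R S 2 r + (3 / r ^ 5) *\<^sub>R S 1 r
    else (1 / r ^ 4) *\<^sub>R S 4 r - (6 / r ^ 5) *\<^sub>R S 3 r + (15 / r ^ 6) *\<^sub>R S 2 r - (15 / r ^ 7) *\<^sub>R S 1 r)"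

lemma quotient_deriv:
  assumes "j < 4" "r > 0"
  shows "((\<lambda>r. (c / r ^ n) *\<^sub>R S j r) has_vector_derivative
     (c / r ^ n) *\<^sub>R S (Suc j) r - (c * n / r ^ Suc n) *\<^sub>R S j r) (at r)"
proof -
  have "((\<lambda>r. c / r ^ n) has_real_derivative - (c * n / r ^ Suc n)) (at r)"
    unfolding divide_inverse
    by (rule DERIV_cong[OF DERIV_cmult[OF DERIV_inverse_fun[OF DERIV_pow]]])
      (use assms(2) in \<open>cases n; simp add: field_simps\<close>)+
  from has_vector_derivative_scaleR[OF this S_deriv_at[OF assms]]
  show ?thesis by simp
qed

lemma T_deriv:
  assumes j: "j < 4" and r: "r > 0"
  shows "(T j has_vector_derivative r *\<^sub>R T (Suc j) r) (at r)"
proof -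
  have *: "(T j has_vector_derivative D) (at r)"
    if "(f has_vector_derivative D) (at r)" "\<And>r. r > 0 \<Longrightarrow> T j r = f r" for f D
    by (rule has_vector_derivative_transform_within_open[OF that(1), of "{0<..}"]) (use that(2) r in auto)
  note q = quotient_deriv[OF _ r]
  consider "j = 0" | "j = 1" | "j = 2" | "j = 3" using j by linarith
  then show ?thesis
  proof cases
    case 1
    have "(S 0 has_vector_derivative r *\<^sub>R T (Suc j) r) (at r)"
      using S_deriv_at[of 0 r] r 1 by (simp add: T_def)
    then show ?thesis by (rule *) (simp add: T_def 1)
  next
    case 2
    have "((\<lambda>r. (1 / r ^ 1) *\<^sub>R S 1 r) has_vector_derivative r *\<^sub>R T (Suc j) r) (at r)"
      by (rule has_vector_derivative_eq_rhs, rule q)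
        (use r 2 in \<open>auto simp: T_def scaleR_diff_right power2_eq_square power3_eq_cube numeral_2_eq_2\<close>)
    then show ?thesis by (rule *) (simp add: T_def 2)
  next
    case 3
    have "((\<lambda>r. (1 / r ^ 2) *\<^sub>R S 2 r - (1 / r ^ 3) *\<^sub>R S 1 r) has_vector_derivative r *\<^sub>R T (Suc j) r) (at r)"
      by (rule has_vector_derivative_eq_rhs[OF has_vector_derivative_diff[OF q[of 2 1 2] q[of 1 1 3]]])
        (use r 3 in \<open>auto simp: T_def complex_eq_iff field_simps eval_nat_numeral\<close>)
    then show ?thesis by (rule *) (simp add: T_def 3)
  next
    case 4
    have "((\<lambda>r. (1 / r ^ 3) *\<^sub>R S 3 r - (3 / r ^ 4) *\<^sub>R S 2 r + (3 / r ^ 5) *\<^sub>R S 1 r) has_vector_derivative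
        r *\<^sub>R T (Suc j) r) (at r)"
      by (rule has_vector_derivative_eq_rhs[OF has_vector_derivative_add[OF
            has_vector_derivative_diff[OF q[of 3 1 3] q[of 2 3 4]] q[of 1 3 5]]])
        (use r 4 in \<open>auto simp: T_def complex_eq_iff field_simps eval_nat_numeral\<close>)
    then show ?thesis by (rule *) (simp add: T_def 4)
  qed
qed

lemma T_cont_pos:
  assumes j: "j \<le> 4"
  shows "continuous_on {0<..} (T j)"
proof (rule continuous_on_eq)
  show "continuous_on {0<..} (\<lambda>r. if j = 0 then S 0 r
    else if j = 1 then (1 / r) *\<^sub>R S 1 r
    else if j = 2 then (1 / r ^ 2) *\<^sub>R S 2 r - (1 / r ^ 3) *\<^sub>R S 1 r
    else if j = 3 then (1 / r ^ 3) *\<^sub>R S 3 r - (3 / r ^ 4) *\<^sub>R S 2 r + (3 / r ^ 5) *\<^sub>R S 1 r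
    else (1 / r ^ 4) *\<^sub>R S 4 r - (6 / r ^ 5) *\<^sub>R S 3 r + (15 / r ^ 6) *\<^sub>R S 2 r - (15 / r ^ 7) *\<^sub>R S 1 r)"
    by (cases "j = 0"; cases "j = 1"; cases "j = 2"; cases "j = 3")
      (auto intro!: continuous_intros continuous_on_subset[OF S_cont])
qed (auto simp: T_def)

text \<open>Common form of the limits of \<open>T 2\<close> and of the weighted \<open>T 3\<close>,
  \<open>T 4\<close>: \<open>c\<close> is what the Taylor polynomials contribute, and each remainder
  is divided by the power of r that \<open>R_small\<close> allows.\<close>

lemma R_combination_small:
  "((\<lambda>r. c + (a\<^sub>0 *\<^sub>R ((1 / r ^ 3) *\<^sub>R R 0 r) + a\<^sub>1 *\<^sub>R ((1 / r ^ 2) *\<^sub>R R 1 r)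
      + a\<^sub>2 *\<^sub>R ((1 / r) *\<^sub>R R 2 r) + a\<^sub>3 *\<^sub>R R 3 r)) \<longlongrightarrow> c) (at_right 0)"
proof -
  have "((\<lambda>r. c + (a\<^sub>0 *\<^sub>R ((1 / r ^ 3) *\<^sub>R R 0 r) + a\<^sub>1 *\<^sub>R ((1 / r ^ 2) *\<^sub>R R 1 r)
      + a\<^sub>2 *\<^sub>R ((1 / r) *\<^sub>R R 2 r) + a\<^sub>3 *\<^sub>R R 3 r)) \<longlongrightarrow>
      c + (a\<^sub>0 *\<^sub>R 0 + a\<^sub>1 *\<^sub>R 0 + a\<^sub>2 *\<^sub>R 0 + a\<^sub>3 *\<^sub>R 0)) (at_right 0)"
    using R_small[of 0] R_small[of 1] R_small[of 2] R_small[of 3]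
    by (intro tendsto_add tendsto_const tendsto_scaleR[OF tendsto_const]) simp_all
  then show ?thesis by simp
qed

lemma T_limit:
  shows "(T 0 \<longlongrightarrow> T 0 0) (at_right 0)" "(T 1 \<longlongrightarrow> T 1 0) (at_right 0)" "(T 2 \<longlongrightarrow> T 2 0) (at_right 0)"
    "((\<lambda>r. r ^ 2 *\<^sub>R T 3 r) \<longlongrightarrow> 0) (at_right 0)" "((\<lambda>r. r ^ 4 *\<^sub>R T 4 r) \<longlongrightarrow> 0) (at_right 0)"
proof -
  have ev: "\<forall>\<^sub>F r in at_right 0. r > (0::real)" by (rule eventually_at_right_less)
  have S: "(S j \<longlongrightarrow> S j 0) (at_right 0)" if "j \<le> 4" for j
  proof -
    have "(S j \<longlongrightarrow> S j 0) (at 0 within {0..})" using S_cont[OF that] by (simp add: continuous_on_def)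
    then show ?thesis by (rule tendsto_within_subset) auto
  qed
  show "(T 0 \<longlongrightarrow> T 0 0) (at_right 0)" using S[of 0] by (simp add: T_def[abs_def])
  have "((\<lambda>r. S 2 0 + (r\<^sup>2 / 6) *\<^sub>R S 4 0 + r\<^sup>2 *\<^sub>R ((1 / r ^ 3) *\<^sub>R R 0 r)) \<longlongrightarrow> S 2 0) (at_right 0)"
  proof -
    have r2: "((\<lambda>r::real. r\<^sup>2) \<longlongrightarrow> 0) (at_right 0)" "((\<lambda>r::real. r\<^sup>2 / 6) \<longlongrightarrow> 0) (at_right 0)"
      by (auto intro!: tendsto_eq_intros)
    show ?thesis
      using tendsto_add[OF tendsto_add[OF tendsto_const tendsto_scaleR[OF r2(2) tendsto_const]]
          tendsto_scaleR[OF r2(1) R_small[of 0]]] by simp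
  qed
  then have "(T 1 \<longlongrightarrow> S 2 0) (at_right 0)"
    by (rule Lim_transform_eventually)
      (rule eventually_mono[OF ev], simp add: T_def R_def complex_eq_iff field_simps eval_nat_numeral)
  then show "(T 1 \<longlongrightarrow> T 1 0) (at_right 0)" by (simp add: T_def)
  \<comment> \<open>The \<open>S 2 0\<close> terms cancel, and \<open>S 4 0\<close> is left with 1/2
    - 1/6 = 1/3.\<close>
  have "(T 2 \<longlongrightarrow> (1/3) *\<^sub>R S 4 0) (at_right 0)"
    by (rule Lim_transform_eventually[OF R_combination_small[where a\<^sub>0 = "-1" and a\<^sub>1 = 1 and a\<^sub>2 = 0 and a\<^sub>3 = 0]])
      (rule eventually_mono[OF ev], simp add: T_def R_def complex_eq_iff field_simps eval_nat_numeral)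
  then show "(T 2 \<longlongrightarrow> T 2 0) (at_right 0)" by (simp add: T_def)
  \<comment> \<open>The polynomial part cancels: 3 - 3 = 0 in front of \<open>S 2 0\<close>, and 3/6
    - 3/2 + 1 = 0 in front of \<open>S 4 0\<close>.\<close>
  show "((\<lambda>r. r ^ 2 *\<^sub>R T 3 r) \<longlongrightarrow> 0) (at_right 0)"
    by (rule Lim_transform_eventually[OF R_combination_small[where a\<^sub>0 = 3 and a\<^sub>1 = "-3" and a\<^sub>2 = 1 and a\<^sub>3 = 0]])
      (rule eventually_mono[OF ev], simp add: T_def R_def complex_eq_iff field_simps eval_nat_numeral)
  \<comment> \<open>Likewise -15 + 15 = 0 and -15/6 + 15/2 - 6 + 1 = 0.\<close>
  show "((\<lambda>r. r ^ 4 *\<^sub>R T 4 r) \<longlongrightarrow> 0) (at_right 0)"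
    by (rule Lim_transform_eventually[OF R_combination_small[where a\<^sub>0 = "-15" and a\<^sub>1 = 15 and a\<^sub>2 = "-6" and a\<^sub>3 = 1]])
      (rule eventually_mono[OF ev], simp add: T_def R_def complex_eq_iff field_simps eval_nat_numeral)
qed

sublocale radial_tower T
proof
  show "(T j has_vector_derivative r *\<^sub>R T (Suc j) r) (at r)" if "j < 4" "r > 0" for j r
    using T_deriv that .
  fix j :: nat assume "j \<le> 2"
  then consider "j = 0" | "j = 1" | "j = 2" by linarith
  then show "continuous_on {0..} (T j)"
    by cases (auto intro!: continuous_on_halflineI T_cont_pos T_limit T_limit(2)[simplified])
next
  have "continuous_on {0<..} (\<lambda>r. r ^ m *\<^sub>R T j r)" if "j \<le> 4" for m j
    using T_cont_pos[OF that] by (intro continuous_intros)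
  then show "continuous_on {0..} (\<lambda>r. r ^ 2 *\<^sub>R T 3 r)" "continuous_on {0..} (\<lambda>r. r ^ 4 *\<^sub>R T 4 r)"
    using T_limit(4,5) by (simp_all add: continuous_on_halflineI)
qed

text \<open>Inserting \<open>T\<close> into \<open>bilaplacian_u0\<close>, S''' / r receives 2D + 4
  - 6 = 2(D - 1), and S'' / r^2 receives D^2 + 2D - 3(2D + 4) + 15 = (D - 1)(D - 3); S' / r^3
  receives the negative of the latter.\<close>

lemma bilaplacian_radial:
  fixes x :: "'a::euclidean_space"
  assumes "x \<noteq> 0"
  shows "bilaplacian u0 x = S 4 (norm x)
     + of_real (2 * (real DIM('a) - 1) / norm x) * S 3 (norm x)
     + of_real ((real DIM('a) - 1) * (real DIM('a) - 3) / (norm x)\<^sup>2) * S 2 (norm x)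
     - of_real ((real DIM('a) - 1) * (real DIM('a) - 3) / norm x ^ 3) * S 1 (norm x)"
proof -
  define r where "r = norm x"
  define D where "D = real DIM('a)"
  have "r > 0" using assms by (simp add: r_def)
  then show ?thesis
    unfolding bilaplacian_u0 scaleR_conv_of_real[symmetric] r_def[symmetric] D_def[symmetric]
    by (simp add: T_def complex_eq_iff field_simps eval_nat_numeral)
qed

end

lemma profile_even_C4:
  assumes "profile_solution d \<sigma> \<nu> \<kappa> S"
  shows "even_C4 (\<lambda>k. (hderiv ^^ k) S)"
proof
  from assms have C4: "C4_halfline S" and S0: "hderiv S 0 = 0" "(hderiv ^^ 3) S 0 = 0"
    by (auto simp: profile_solution_def)
  show "((hderiv ^^ j) S has_vector_derivative (hderiv ^^ Suc j) S r) (at r within {0..})"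
    if "j < 4" "r \<ge> 0" for j r
    using C4 that by (auto simp: C4_halfline_def hderiv_def[of "(hderiv ^^ j) S"] vector_derivative_works)
  show "continuous_on {0..} ((hderiv ^^ 4) S)" using C4 by (simp add: C4_halfline_def)
  show "(hderiv ^^ 1) S 0 = 0" "(hderiv ^^ 3) S 0 = 0" using S0 by simp_all
qed

section \<open>Spatial dilations\<close>

text \<open>For l = 0 the function is constant and division by zero makes the right side 0, so the
  formula needs no condition on \<open>l\<close>. This lets \<open>space_Ck_scaled\<close> rewrite
  the partial derivatives at all times, including those outside \<open>I\<close>.\<close>

lemma partial_deriv_scaled:
  fixes G :: "'a::euclidean_space \<Rightarrow> complex"
  assumes "\<And>x. (\<lambda>h. G (x + h *\<^sub>R b)) differentiable (at 0)"
  shows "((\<lambda>h. c * G ((x + h *\<^sub>R b) /\<^sub>R l)) has_vector_derivative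
      c / of_real l * partial_deriv b G (x /\<^sub>R l)) (at 0)"
proof -
  have "((\<lambda>h. G (x /\<^sub>R l + h *\<^sub>R b)) has_vector_derivative partial_deriv b G (x /\<^sub>R l)) (at (0 / l))"
    using assms[of "x /\<^sub>R l"] by (simp add: vector_derivative_works partial_deriv_def)
  moreover have "((\<lambda>h. h / l) has_vector_derivative 1 / l) (at 0)"
    by (auto intro!: derivative_eq_intros simp: divide_inverse)
  ultimately have "((\<lambda>h. G (x /\<^sub>R l + (h / l) *\<^sub>R b)) has_vector_derivative
      (1 / l) *\<^sub>R partial_deriv b G (x /\<^sub>R l)) (at 0)"
    using vector_diff_chain_at[of "\<lambda>h. h / l" "1 / l" 0 "\<lambda>h. G (x /\<^sub>R l + h *\<^sub>R b)"
        "partial_deriv b G (x /\<^sub>R l)"] by (simp add: o_def)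
  from has_vector_derivative_mult_right[OF this, of c]
  show ?thesis
    by (simp add: scaleR_add_right divide_inverse scaleR_conv_of_real mult_ac)
qed

text \<open>Differentiation preserves the shape: \<open>c\<close> becomes c / l and \<open>G\<close>
  becomes its partial derivative. The induction therefore generalizes over both.\<close>

lemma space_Ck_scaled:
  fixes G :: "'a::euclidean_space \<Rightarrow> complex"
  assumes "space_Ck k UNIV (\<lambda>_. G)" "continuous_on I c" "continuous_on I l" "\<forall>t\<in>I. l t \<noteq> 0"
  shows "space_Ck k I (\<lambda>t x. c t * G (x /\<^sub>R l t))"
proof -
  have joint: "continuous_on (I \<times> UNIV) (\<lambda>(t, x). c t * G (x /\<^sub>R l t))"
    if G: "continuous_on (UNIV \<times> UNIV) (\<lambda>(t::real, x). G x)" and c: "continuous_on I c"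
    for G :: "'a \<Rightarrow> complex" and c
  proof -
    have "continuous_on UNIV (\<lambda>x. case (0::real, x) of (t, x) \<Rightarrow> G x)"
      by (rule continuous_on_compose2[OF G]) (auto intro!: continuous_intros)
    then have G': "continuous_on UNIV G" by simp
    have "continuous_on (I \<times> (UNIV :: 'a set)) (\<lambda>z. l (fst z))"
      by (rule continuous_on_compose2[OF assms(3)]) (auto intro!: continuous_intros)
    then have l: "continuous_on (I \<times> (UNIV :: 'a set)) (\<lambda>z. snd z /\<^sub>R l (fst z))"
      using assms(4) by (intro continuous_intros) auto
    have "continuous_on (I \<times> (UNIV :: 'a set)) (\<lambda>z. c (fst z))"
      by (rule continuous_on_compose2[OF c]) (auto intro!: continuous_intros)
    moreover have "continuous_on (I \<times> UNIV) (\<lambda>z. G (snd z /\<^sub>R l (fst z)))"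
      by (rule continuous_on_compose2[OF G' l]) simp
    ultimately show ?thesis unfolding case_prod_beta by (rule continuous_on_mult)
  qed
  show ?thesis using assms(1,2)
  proof (induction k arbitrary: G c)
    case 0
    then show ?case using joint by simp
  next
    case (Suc k)
    have diff: "(\<lambda>h. G (x + h *\<^sub>R b)) differentiable (at 0)" if "b \<in> Basis" for x b
      using Suc.prems(1) that by simp
    have "space_Ck k I (\<lambda>t. partial_deriv b (\<lambda>x. c t * G (x /\<^sub>R l t)))" if b: "b \<in> Basis" for b
    proof -
      have "partial_deriv b (\<lambda>x. c t * G (x /\<^sub>R l t)) = (\<lambda>x. c t / of_real (l t) * partial_deriv b G (x /\<^sub>R l t))" for t
        unfolding partial_deriv_def[of b "\<lambda>x. c t * G (x /\<^sub>R l t)"]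
        by (intro ext vector_derivative_at partial_deriv_scaled diff b)
      moreover have "space_Ck k I (\<lambda>t x. c t / of_real (l t) * partial_deriv b G (x /\<^sub>R l t))"
        using Suc.prems b assms(3,4) by (intro Suc.IH) (auto intro!: continuous_intros)
      ultimately show ?thesis by simp
    qed
    moreover have "(\<lambda>h. c t * G ((x + h *\<^sub>R b) /\<^sub>R l t)) differentiable (at 0)" if "b \<in> Basis" for t x b
      by (rule differentiableI_vector, rule partial_deriv_scaled, rule diff, rule that)
    ultimately show ?case using joint Suc.prems by auto
  qed
qed

lemma laplacian_scaled:
  fixes G :: "'a::euclidean_space \<Rightarrow> complex"
  assumes "space_Ck 2 UNIV (\<lambda>_. G)"
  shows "laplacian (\<lambda>x. c * G (x /\<^sub>R l)) = (\<lambda>x. c / of_real l ^ 2 * laplacian G (x /\<^sub>R l))"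
proof -
  have C1: "(\<lambda>h. G (x + h *\<^sub>R b)) differentiable (at 0)"
    "(\<lambda>h. partial_deriv b G (x + h *\<^sub>R b)) differentiable (at 0)" if "b \<in> Basis" for x b
    using assms that by (simp_all add: numeral_2_eq_2)
  have p: "partial_deriv b (\<lambda>x. c * G (x /\<^sub>R l)) = (\<lambda>x. c / of_real l * partial_deriv b G (x /\<^sub>R l))"
    "partial_deriv b (\<lambda>x. c / of_real l * partial_deriv b G (x /\<^sub>R l)) =
      (\<lambda>x. c / of_real l / of_real l * partial_deriv b (partial_deriv b G) (x /\<^sub>R l))"
    if "b \<in> Basis" for b
    unfolding partial_deriv_def[of b "\<lambda>x. _ * _ (x /\<^sub>R l)"]
    by (intro ext vector_derivative_at partial_deriv_scaled C1 that)+
  show ?thesis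
    unfolding laplacian_def sum_distrib_left
    by (intro ext sum.cong refl) (simp only: p, simp add: power2_eq_square)
qed

lemma space_Ck_sum:
  fixes f :: "'i \<Rightarrow> 'a::euclidean_space \<Rightarrow> complex"
  assumes "\<And>i. i \<in> A \<Longrightarrow> space_Ck k UNIV (\<lambda>_. f i)"
  shows "space_Ck k UNIV (\<lambda>_ x. \<Sum>i\<in>A. f i x)"
  using assms
proof (induction k arbitrary: f)
  case 0
  then show ?case by (simp add: case_prod_beta continuous_on_sum)
next
  case (Suc k)
  have deriv: "((\<lambda>h. \<Sum>i\<in>A. f i (x + h *\<^sub>R b)) has_vector_derivative
      (\<Sum>i\<in>A. partial_deriv b (f i) x)) (at 0)" if "b \<in> Basis" for x b
    using Suc.prems that unfolding partial_deriv_def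
    by (intro has_vector_derivative_sum) (simp add: vector_derivative_works[symmetric])
  have partial: "partial_deriv b (\<lambda>x. \<Sum>i\<in>A. f i x) = (\<lambda>x. \<Sum>i\<in>A. partial_deriv b (f i) x)"
    if "b \<in> Basis" for b
    unfolding partial_deriv_def[of b "\<lambda>x. \<Sum>i\<in>A. f i x"]
    by (intro ext vector_derivative_at deriv that)
  have "continuous_on (UNIV \<times> UNIV) (\<lambda>(t::real, x). \<Sum>i\<in>A. f i x)"
    using Suc.prems by (simp add: case_prod_beta continuous_on_sum)
  moreover have "space_Ck k UNIV (\<lambda>_. partial_deriv b (\<lambda>x. \<Sum>i\<in>A. f i x))" if "b \<in> Basis" for b
    unfolding partial[OF that] using Suc.prems that by (intro Suc.IH) simp
  ultimately show ?case
    using differentiableI_vector[OF deriv] by simp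
qed

lemma space_Ck_laplacian:
  fixes G :: "'a::euclidean_space \<Rightarrow> complex"
  assumes "space_Ck (Suc (Suc k)) UNIV (\<lambda>_. G)"
  shows "space_Ck k UNIV (\<lambda>_. laplacian G)"
  unfolding laplacian_def[abs_def] using assms by (intro space_Ck_sum) simp

text \<open>\<open>laplacian_scaled\<close> is applied twice, to \<open>G\<close> and to
  \<open>laplacian G\<close>, each time contributing l^-2; the second use is why
  \<open>laplacian G\<close> must be known to be C^2.\<close>

lemma bilaplacian_scaled:
  fixes G :: "'a::euclidean_space \<Rightarrow> complex"
  assumes G: "space_Ck 4 UNIV (\<lambda>_. G)"
  shows "bilaplacian (\<lambda>x. c * G (x /\<^sub>R l)) x = c / of_real l ^ 4 * bilaplacian G (x /\<^sub>R l)"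
proof -
  have four: "4 = Suc (Suc 2)" by simp
  have "space_Ck 2 UNIV (\<lambda>_. laplacian G)"
    using G unfolding four by (rule space_Ck_laplacian)
  moreover have "space_Ck 2 UNIV (\<lambda>_. G)"
    using G by (auto simp: eval_nat_numeral)
  ultimately show ?thesis
    by (simp only: bilaplacian_def laplacian_scaled) (simp add: power2_eq_square power4_eq_xxxx)
qed

section \<open>Time dependence: scale, phase and amplitude\<close>

lemma blowup_scale_pos: "\<kappa> > 0 \<Longrightarrow> t < Tc \<Longrightarrow> blowup_scale \<kappa> Tc t > 0"
  by (simp add: blowup_scale_def)

lemma blowup_scale_power4: "t < Tc \<Longrightarrow> blowup_scale \<kappa> Tc t ^ 4 = \<kappa> ^ 4 * (Tc - t)"
  by (simp add: blowup_scale_def power_mult_distrib powr_power)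

lemma blowup_scale_deriv:
  assumes "\<kappa> > 0" "t < Tc"
  shows "(blowup_scale \<kappa> Tc has_real_derivative - (\<kappa> ^ 4 / 4) / blowup_scale \<kappa> Tc t ^ 3) (at t)"
proof -
  define L where "L = blowup_scale \<kappa> Tc t"
  have L: "L > 0" "L ^ 4 = \<kappa> ^ 4 * (Tc - t)"
    using blowup_scale_pos[OF assms] blowup_scale_power4[OF assms(2)] by (simp_all add: L_def)
  \<comment> \<open>Differentiating \<open>powr\<close> produces the exponent -3/4; in the form
    \<open>L / (Tc - t)\<close> the relation L^4 = \<kappa>^4 (Tc - t) becomes applicable.\<close>
  have "(Tc - t) powr - (3 / 4) = (Tc - t) powr (1 / 4) / (Tc - t)"
    using powr_diff[of "Tc - t" "1 / 4" 1] assms by simp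
  then have "(blowup_scale \<kappa> Tc has_real_derivative - (1 / 4) * (L / (Tc - t))) (at t)"
    unfolding blowup_scale_def[abs_def] L_def
    using assms by (auto intro!: derivative_eq_intros)
  moreover have "- (1 / 4) * (L / (Tc - t)) = - (\<kappa> ^ 4 / 4) / L ^ 3"
    using L assms by (simp add: field_simps eval_nat_numeral)
  ultimately show ?thesis by (simp add: L_def)
qed

lemma phase_integral:
  assumes "\<kappa> > 0" "0 \<le> t" "t < Tc"
  shows "integral {0..t} (\<lambda>s. 1 / blowup_scale \<kappa> Tc s ^ 4) = (ln Tc - ln (Tc - t)) / \<kappa> ^ 4"
proof (rule integral_unique)
  have "((\<lambda>s. 1 / blowup_scale \<kappa> Tc s ^ 4) has_integral
      (- ln (Tc - t) / \<kappa> ^ 4 - - ln (Tc - 0) / \<kappa> ^ 4)) {0..t}"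
  proof (rule fundamental_theorem_of_calculus)
    fix s assume s: "s \<in> {0..t}"
    then have "((\<lambda>s. - ln (Tc - s) / \<kappa> ^ 4) has_real_derivative 1 / blowup_scale \<kappa> Tc s ^ 4) (at s)"
      using assms by (auto intro!: derivative_eq_intros simp: blowup_scale_power4 field_simps)
    then show "((\<lambda>s. - ln (Tc - s) / \<kappa> ^ 4) has_vector_derivative 1 / blowup_scale \<kappa> Tc s ^ 4)
        (at s within {0..t})"
      by (simp add: has_real_derivative_iff_has_vector_derivative has_vector_derivative_at_within)
  qed (use assms in simp)
  then show "((\<lambda>s. 1 / blowup_scale \<kappa> Tc s ^ 4) has_integral (ln Tc - ln (Tc - t)) / \<kappa> ^ 4) {0..t}"
    by (simp add: diff_divide_distrib)
qed

text \<open>L^4 is linear in t, so the phase is logarithmic and its derivative is read off from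
  \<open>phase_integral\<close>. That closed form requires t \<ge> 0: for negative t the interval
  \<open>{0..t}\<close> is empty and the integral is 0. Hence the derivative is relative to [0, Tc),
  one-sided at 0.\<close>

lemma phase_deriv:
  assumes "\<kappa> > 0" "t \<in> {0..<Tc}"
  shows "((\<lambda>t. integral {0..t} (\<lambda>s. 1 / blowup_scale \<kappa> Tc s ^ 4)) has_real_derivative
      1 / blowup_scale \<kappa> Tc t ^ 4) (at t within {0..<Tc})"
proof (rule has_field_derivative_transform_within[where d = 1])
  show "((\<lambda>t. (ln Tc - ln (Tc - t)) / \<kappa> ^ 4) has_real_derivative
      1 / blowup_scale \<kappa> Tc t ^ 4) (at t within {0..<Tc})"
    using assms by (auto intro!: derivative_eq_intros simp: blowup_scale_power4 field_simps)
qed (use assms in \<open>auto simp: phase_integral\<close>)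

definition amplitude :: "real \<Rightarrow> real \<Rightarrow> real \<Rightarrow> real \<Rightarrow> real \<Rightarrow> complex" where
  "amplitude \<sigma> \<nu> \<kappa> Tc t = of_real (1 / blowup_scale \<kappa> Tc t powr (2 / \<sigma>))
     * exp (\<i> * of_real (\<nu> * integral {0..t} (\<lambda>s. 1 / blowup_scale \<kappa> Tc s ^ 4)))"

lemma self_similar_eq:
  assumes "\<kappa> > 0"
  shows "self_similar \<sigma> \<nu> \<kappa> Tc S =
     (\<lambda>t x. amplitude \<sigma> \<nu> \<kappa> Tc t * S (norm (x /\<^sub>R blowup_scale \<kappa> Tc t)))"
proof -
  \<comment> \<open>\<open>powr\<close> is never negative, so this includes times beyond
    \<open>Tc\<close> and the claim can be an equality of functions.\<close>
  have "blowup_scale \<kappa> Tc t \<ge> 0" for t using assms by (simp add: blowup_scale_def)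
  then show ?thesis
    by (simp add: fun_eq_iff self_similar_def amplitude_def divide_inverse mult_ac)
qed

text \<open>The logarithmic derivative is -(2/\<sigma>) L'/L from the modulus plus i \<nu> / L^4
  from the phase.\<close>

lemma amplitude_deriv:
  assumes \<kappa>: "\<kappa> > 0" and t: "t \<in> {0..<Tc}"
  shows "(amplitude \<sigma> \<nu> \<kappa> Tc has_vector_derivative
      amplitude \<sigma> \<nu> \<kappa> Tc t / of_real (blowup_scale \<kappa> Tc t ^ 4)
        * (of_real (\<kappa> ^ 4 / 4 * (2 / \<sigma>)) + \<i> * of_real \<nu>)) (at t within {0..<Tc})"
proof -
  define L where "L = blowup_scale \<kappa> Tc t"
  define p where "p = 2 / \<sigma>"
  define \<theta> where "\<theta> t = integral {0..t} (\<lambda>s. 1 / blowup_scale \<kappa> Tc s ^ 4)" for t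
  have L: "L > 0" using blowup_scale_pos \<kappa> t by (simp add: L_def)
  have "((\<lambda>l. 1 / l powr p) has_real_derivative - p / (L * L powr p)) (at L)"
    using L by (auto intro!: derivative_eq_intros simp: powr_diff field_simps power2_eq_square)
  from DERIV_chain2[OF this[unfolded L_def] blowup_scale_deriv[OF \<kappa>]]
  have "((\<lambda>t. 1 / blowup_scale \<kappa> Tc t powr p) has_real_derivative
      (\<kappa> ^ 4 / 4 * p / L ^ 4) * (1 / L powr p)) (at t)"
    using L t by (simp add: L_def[symmetric] eval_nat_numeral field_simps)
  then have A: "((\<lambda>t. complex_of_real (1 / blowup_scale \<kappa> Tc t powr p)) has_vector_derivative
      of_real ((\<kappa> ^ 4 / 4 * p / L ^ 4) * (1 / L powr p))) (at t within {0..<Tc})"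
    by (intro has_vector_derivative_of_real)
      (simp add: has_real_derivative_iff_has_vector_derivative has_vector_derivative_at_within
        has_field_derivative_at_within)
  have "((\<lambda>t. \<nu> * \<theta> t) has_real_derivative \<nu> * (1 / L ^ 4)) (at t within {0..<Tc})"
    unfolding \<theta>_def L_def by (intro DERIV_cmult phase_deriv \<kappa> t)
  then have "((\<lambda>t. \<i> * of_real (\<nu> * \<theta> t)) has_vector_derivative \<i> * of_real (\<nu> * (1 / L ^ 4)))
      (at t within {0..<Tc})"
    by (intro has_vector_derivative_mult_right has_vector_derivative_of_real)
  from field_vector_diff_chain_within[OF this, of exp "exp (\<i> * of_real (\<nu> * \<theta> t))"]
  have E: "((\<lambda>t. exp (\<i> * of_real (\<nu> * \<theta> t))) has_vector_derivative
      \<i> * of_real (\<nu> * (1 / L ^ 4)) * exp (\<i> * of_real (\<nu> * \<theta> t))) (at t within {0..<Tc})"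
    by (simp add: o_def DERIV_exp has_field_derivative_at_within)
  have "(amplitude \<sigma> \<nu> \<kappa> Tc) = (\<lambda>t. of_real (1 / blowup_scale \<kappa> Tc t powr p) * exp (\<i> * of_real (\<nu> * \<theta> t)))"
    by (simp add: fun_eq_iff amplitude_def p_def \<theta>_def)
  with has_vector_derivative_mult[OF A E] show ?thesis
    using L by (simp add: L_def[symmetric] p_def[symmetric] field_simps)
qed

text \<open>The phase has modulus 1, and (L^(-2/\<sigma>))^(2\<sigma>) = L^-4: the exponent
  2/\<sigma> is the one for which the nonlinearity scales like the bilaplacian.\<close>

lemma norm_amplitude_powr:
  assumes "\<kappa> > 0" "t < Tc" "\<sigma> > 0"
  shows "norm (amplitude \<sigma> \<nu> \<kappa> Tc t * z) powr (2 * \<sigma>) =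
     norm z powr (2 * \<sigma>) / blowup_scale \<kappa> Tc t ^ 4"
proof -
  define L where "L = blowup_scale \<kappa> Tc t"
  have L: "L > 0" using blowup_scale_pos assms by (simp add: L_def)
  have "norm (amplitude \<sigma> \<nu> \<kappa> Tc t * z) = norm z / L powr (2 / \<sigma>)"
    by (simp add: amplitude_def norm_mult L_def[symmetric] norm_divide)
  moreover have "(L powr (2 / \<sigma>)) powr (2 * \<sigma>) = L ^ 4"
    using L assms(3) powr_realpow[of L 4] by (simp add: powr_powr)
  ultimately show ?thesis by (simp add: powr_divide L_def)
qed

section \<open>The equation satisfied by the ansatz\<close>

text \<open>Stated with the full bilaplacian because the radial expression is wrong at 0 in general:
  with division by zero equal to 0 it reduces to S''''(0), whereas the true value there is (d^2 +
  2d)/3 times that.\<close>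

lemma profile_equation_everywhere:
  fixes y :: "'a::euclidean_space"
  assumes P: "profile_solution DIM('a) \<sigma> \<nu> \<kappa> S" and \<sigma>: "\<sigma> > 0"
  shows "- of_real \<nu> * S (norm y)
        + \<i> * of_real (\<kappa> ^ 4 / 4) * (of_real (2 / \<sigma>) * S (norm y) + of_real (norm y) * hderiv S (norm y))
        - bilaplacian (\<lambda>x::'a. S (norm x)) y
        + of_real (norm (S (norm y)) powr (2 * \<sigma>)) * S (norm y) = 0" (is "?E y = 0")
proof -
  interpret even_C4 "\<lambda>k. (hderiv ^^ k) S" by (rule profile_even_C4[OF P])
  have u0: "u0 = (\<lambda>x::'a. S (norm x))" by (simp add: fun_eq_iff u0_def T_def)
  have norm_cont: "continuous_on UNIV (norm :: 'a \<Rightarrow> real)"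
    by (rule continuous_on_norm[OF continuous_on_id])
  have norm_range: "range (norm :: 'a \<Rightarrow> real) \<subseteq> {0..}" by auto
  have S: "continuous_on UNIV (\<lambda>x::'a. S (norm x))" "continuous_on UNIV (\<lambda>x::'a. hderiv S (norm x))"
    using continuous_on_compose2[OF S_cont[of 0] norm_cont norm_range]
      continuous_on_compose2[OF S_cont[of 1] norm_cont norm_range]
    by auto
  \<comment> \<open>\<open>S\<close> may have zeros, where the power is continuous because its
    exponent is positive.\<close>
  have pow: "continuous_on UNIV (\<lambda>x::'a. norm (S (norm x)) powr (2 * \<sigma>))"
    by (rule continuous_on_powr'[OF continuous_on_norm[OF S(1)] continuous_on_const]) (use \<sigma> in simp)
  have bil: "continuous_on UNIV (bilaplacian (\<lambda>x::'a. S (norm x)))"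
    using continuous_bilaplacian_u0[where 'a = 'a] unfolding u0 .
  have cont: "continuous_on UNIV ?E"
    by (intro continuous_on_add continuous_on_diff continuous_on_mult continuous_on_of_real
        continuous_on_const S norm_cont pow bil)
  have off: "?E x = 0" if "x \<noteq> 0" for x :: 'a
  proof -
    have "bilaplacian (\<lambda>x::'a. S (norm x)) x = radial_bilaplacian DIM('a) S (norm x)"
      using bilaplacian_radial[OF that] unfolding u0 by (simp add: radial_bilaplacian_def)
    then show ?thesis using P that by (simp add: profile_solution_def)
  qed
  \<comment> \<open>the profile equation is only given off the origin; both sides are continuous there\<close>
  have dense: "closure (- {0 :: 'a}) = UNIV" by (simp add: closure_complement)
  show ?thesis
    by (rule continuous_constant_on_closure[of "- {0 :: 'a}" ?E]) (use cont off dense in auto)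
qed

lemma self_similar_solution:
  assumes P: "profile_solution DIM('a) \<sigma> \<nu> \<kappa> S" and \<sigma>: "\<sigma> > 0" and \<kappa>: "\<kappa> > 0"
  shows "bnls_solution \<sigma> {0..<Tc} (self_similar \<sigma> \<nu> \<kappa> Tc S :: real \<Rightarrow> 'a::euclidean_space \<Rightarrow> complex)"
proof -
  interpret even_C4 "\<lambda>k. (hderiv ^^ k) S" by (rule profile_even_C4[OF P])
  define G where "G = (\<lambda>x::'a. S (norm x))"
  define I where "I = {0..<Tc}"
  define L where "L = blowup_scale \<kappa> Tc"
  define c where "c = amplitude \<sigma> \<nu> \<kappa> Tc"
  \<comment> \<open>The product rule: c' comes from \<open>amplitude_deriv\<close>, and \<rho> = |x|
    / L satisfies \<rho>' = -\<rho> L'/L = (\<kappa>^4/4) \<rho> / L^4.\<close>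
  define \<psi>\<^sub>t where "\<psi>\<^sub>t t x = c t / of_real (L t ^ 4) *
    ((of_real (\<kappa> ^ 4 / 4 * (2 / \<sigma>)) + \<i> * of_real \<nu>) * S (norm x / L t)
      + of_real (\<kappa> ^ 4 / 4 * (norm x / L t)) * hderiv S (norm x / L t))" for t and x :: 'a
  have \<psi>: "self_similar \<sigma> \<nu> \<kappa> Tc S = (\<lambda>t x. c t * G (x /\<^sub>R L t))"
    using self_similar_eq[OF \<kappa>] by (simp add: c_def G_def L_def)
  have L_pos: "L t > 0" if "t \<in> I" for t
    using that blowup_scale_pos \<kappa> by (simp add: L_def I_def)
  have c_deriv: "(c has_vector_derivative c t / of_real (L t ^ 4)
        * (of_real (\<kappa> ^ 4 / 4 * (2 / \<sigma>)) + \<i> * of_real \<nu>)) (at t within I)" if "t \<in> I" for t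
    using amplitude_deriv[OF \<kappa>] that by (simp add: c_def L_def I_def)
  have L_deriv: "(L has_real_derivative - (\<kappa> ^ 4 / 4) / L t ^ 3) (at t)" if "t \<in> I" for t
    using blowup_scale_deriv[OF \<kappa>, of t Tc] that by (simp add: L_def I_def)
  have c_cont: "continuous_on I c"
    unfolding continuous_on_eq_continuous_within
    by (intro ballI has_vector_derivative_continuous[OF c_deriv])
  have L_cont: "continuous_on I L"
    using L_deriv DERIV_isCont by (auto intro!: continuous_at_imp_continuous_on)
  have G_C4: "space_Ck 4 UNIV (\<lambda>_. G)"
    using space_C4_u0[where 'a = 'a] by (simp add: G_def u0_def[abs_def] T_def)
  have C4: "space_Ck 4 I (\<lambda>t x. c t * G (x /\<^sub>R L t))"
    by (rule space_Ck_scaled[OF G_C4 c_cont L_cont]) (use L_pos in force)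
  have cont_comp: "continuous_on (I \<times> UNIV) (\<lambda>z. f (norm (snd z) / L (fst z)))"
    if "continuous_on {0..} f" for f :: "real \<Rightarrow> complex"
  proof (rule continuous_on_compose2[OF that])
    show "continuous_on (I \<times> UNIV) (\<lambda>z. norm (snd z) / L (fst z))"
      using L_pos by (force intro!: continuous_intros continuous_on_compose2[OF L_cont])
    show "(\<lambda>z. norm (snd z) / L (fst z)) ` (I \<times> UNIV) \<subseteq> {0..}"
      using L_pos by (force simp: divide_nonneg_pos)
  qed
  have \<psi>\<^sub>t_cont: "continuous_on (I \<times> UNIV) (\<lambda>(t, x). \<psi>\<^sub>t t x)"
  proof -
    have "continuous_on (I \<times> UNIV) (\<lambda>z. L (fst z))" "continuous_on (I \<times> UNIV) (\<lambda>z. c (fst z))"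
      by (auto intro!: continuous_on_compose2[OF L_cont] continuous_on_compose2[OF c_cont] continuous_intros)
    moreover have "L (fst z) \<noteq> 0" if "z \<in> I \<times> (UNIV :: 'a set)" for z
      using that L_pos[of "fst z"] by auto
    ultimately show ?thesis
      unfolding case_prod_beta \<psi>\<^sub>t_def
      using cont_comp[OF S_cont[of 0]] cont_comp[OF S_cont[of 1]]
      by (intro continuous_intros) auto
  qed
  have \<psi>\<^sub>t_deriv: "((\<lambda>s. c s * G (x /\<^sub>R L s)) has_vector_derivative \<psi>\<^sub>t t x) (at t within I)"
    if t: "t \<in> I" for t x
  proof -
    define \<rho> where "\<rho> s = norm x / L s" for s
    have "(\<rho> has_real_derivative \<kappa> ^ 4 / 4 * \<rho> t / L t ^ 4) (at t)"
      unfolding \<rho>_def using L_pos[OF t]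
      by (auto intro!: derivative_eq_intros L_deriv[OF t] simp: field_simps eval_nat_numeral)
    then have \<rho>: "(\<rho> has_vector_derivative \<kappa> ^ 4 / 4 * \<rho> t / L t ^ 4) (at t within I)"
      by (simp add: has_real_derivative_iff_has_vector_derivative has_vector_derivative_at_within)
    have nonneg: "\<rho> s \<ge> 0" if "s \<in> I" for s using L_pos[OF that] by (simp add: \<rho>_def)
    \<comment> \<open>\<open>S\<close> is differentiable only within the half-line, so the chain
      rule is taken within the image of \<rho>, which lies in \<open>{0..}\<close> and is the single
      point 0 when x = 0.\<close>
    have "(S has_vector_derivative hderiv S (\<rho> t)) (at (\<rho> t) within \<rho> ` I)"
      by (rule has_vector_derivative_within_subset[of _ _ _ "{0..}"])
        (use S_deriv[of 0 "\<rho> t"] nonneg t in auto)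
    from has_vector_derivative_mult[OF c_deriv[OF t] vector_diff_chain_within[OF \<rho> this]]
    have "((\<lambda>s. c s * S (\<rho> s)) has_vector_derivative \<psi>\<^sub>t t x) (at t within I)"
      using L_pos[OF t] by (simp add: \<psi>\<^sub>t_def \<rho>_def o_def scaleR_conv_of_real field_simps)
    then show ?thesis
      by (rule has_vector_derivative_transform[rotated 2])
        (use t L_pos in \<open>auto simp: G_def \<rho>_def divide_inverse mult_ac abs_of_pos\<close>)
  qed
  have eq: "\<i> * \<psi>\<^sub>t t x - bilaplacian (\<lambda>x. c t * G (x /\<^sub>R L t)) x
        + of_real (norm (c t * G (x /\<^sub>R L t)) powr (2 * \<sigma>)) * (c t * G (x /\<^sub>R L t)) = 0"
    if t: "t \<in> I" for t x
  proof -
    define y where "y = x /\<^sub>R L t"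
    define B where "B = bilaplacian G y"
    define N where "N = complex_of_real (norm (G y) powr (2 * \<sigma>))"
    have L: "L t > 0" using L_pos t by simp
    have y: "norm x / L t = norm y" using L by (simp add: y_def divide_inverse mult_ac)
    have bil: "bilaplacian (\<lambda>x. c t * G (x /\<^sub>R L t)) x = c t / of_real (L t ^ 4) * B"
      by (simp add: bilaplacian_scaled[OF G_C4] B_def y_def)
    have non: "of_real (norm (c t * G y) powr (2 * \<sigma>)) = N / of_real (L t ^ 4)"
      using t \<kappa> \<sigma> by (simp add: c_def L_def I_def N_def norm_amplitude_powr)
    \<comment> \<open>Every term carries the factor c / L^4, and i * i \<nu> = -\<nu> supplies the
      first term of the profile equation.\<close>
    have "\<i> * \<psi>\<^sub>t t x - c t / of_real (L t ^ 4) * B + N / of_real (L t ^ 4) * (c t * G y)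
      = c t / of_real (L t ^ 4) * (- of_real \<nu> * S (norm y)
        + \<i> * of_real (\<kappa> ^ 4 / 4) * (of_real (2 / \<sigma>) * S (norm y) + of_real (norm y) * hderiv S (norm y))
        - B + N * S (norm y))"
      by (simp add: \<psi>\<^sub>t_def y G_def algebra_simps add_divide_distrib)
    also have "\<dots> = 0"
      using profile_equation_everywhere[OF P \<sigma>, of y] by (simp add: G_def B_def N_def)
    finally show ?thesis unfolding bil non y_def[symmetric] .
  qed
  show ?thesis
    unfolding bnls_solution_def \<psi> I_def[symmetric] using C4 \<psi>\<^sub>t_cont \<psi>\<^sub>t_deriv eq by blast
qed

theorem lemma4:
  fixes \<sigma> \<nu> \<kappa> Tc :: real and S :: "real \<Rightarrow> complex"
  assumes existence: "\<forall>d \<sigma>'. admissible d \<sigma>' \<longrightarrow>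
      (\<exists>\<kappa>' S'. \<kappa>' > 0 \<and> nontrivial_profile S' \<and> profile_solution d \<sigma>' 1 \<kappa>' S')"
    and range: "admissible CARD('n::finite) \<sigma>"
    and kappa: "\<kappa> > 0"
    and profile: "profile_solution CARD('n) \<sigma> \<nu> \<kappa> S"
    and nontrivial: "nontrivial_profile S"
    and Tc: "Tc > 0"
  shows "bnls_solution \<sigma> {0..<Tc}
      (self_similar \<sigma> \<nu> \<kappa> Tc S :: real \<Rightarrow> real ^ 'n \<Rightarrow> complex)"
proof (rule self_similar_solution)
  have "4 / real CARD('n) > 0" by simp
  then show "\<sigma> > 0" using range unfolding admissible_def by linarith
qed (use profile kappa in simp_all)

end
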